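(* Let $Q$ be any binary quadratic form in the sense below (not necessarily irreducible or indefinite). (1) If $Q\notin\mathcal{F}_+\cup\mathcal{F}_-$, then $\mathcal{S}(Q)=\{\pm I\}$. (2) If $Q\in\mathcal{F}_+$, then $\mathcal{S}(Q)=\chi_Q(\mathcal{U}_f)\cong(\mathbb{Z}/2\mathbb{Z})\times\mathbb{Z}$, where $f$ is the conductor of $Q$. (3) If $Q\in\mathcal{F}_-$, then $\mathcal{S}(Q)=\langle SQ\rangle\cong\mathbb{Z}/4\mathbb{Z}$ if $\Delta(Q)=-4$; $\mathcal{S}(Q)=\langle \tfrac12 I+SQ\rangle\cong\mathbb{Z}/6\mathbb{Z}$ if $\Delta(Q)=-3$; $\mathcal{S}(Q)=\langle -I,\ I+SQ\rangle\cong(\mathbb{Z}/2\mathbb{Z})\times\mathbb{Z}$ if $\Delta(Q)=0$; $\mathcal{S}(Q)=\langle -I,\ 2SQ\rangle\cong(\mathbb{Z}/2\mathbb{Z})\times(\mathbb{Z}/2\mathbb{Z})$ if $\Delta(Q)=1$; $\mathcal{S}(Q)=\langle -I,\ SQ\rangle\cong(\mathbb{Z}/2\mathbb{Z})\times(\mathbb{Z}/2\mathbb{Z})$ if $\Delta(Q)=4$.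
   Context: Here a form is $Q(x,y)=ax^2+bxy+cy^2$ with $a,b,c$ coprime integers, identified with the matrix $Q=\begin{pmatrix}a&b/2\\ b/2&c\end{pmatrix}$; its discriminant is $\Delta(Q)=b^2-4ac$. $\mathcal{S}(Q)=\{M\in GL_2(\mathbb{Z}):\det(M)M^{T}QM=Q\}$ is the stability group. $S=\begin{pmatrix}0&-1\\1&0\end{pmatrix}$. $\mathcal{F}_+$ is the set of forms that are indefinite and irreducible over $\mathbb{Q}$; $\mathcal{F}_-$ is the set of forms with discriminant in $\{-4,-3,0,1,4\}$. For $Q\in\mathcal{F}_+$ with discriminant $\Delta$: let $D$ be the square-free part of $\Delta$, $\Delta_0=D$ if $D\equiv1\pmod4$ and $\Delta_0=4D$ otherwise, $f=\sqrt{\Delta/\Delta_0}$ (the conductor), $K=\mathbb{Q}(\sqrt{\Delta_0})$, $\mathcal{O}_f=\{m+nf\frac{\Delta_0+\sqrt{\Delta_0}}{2}:m,n\in\mathbb{Z}\}$, $\mathcal{U}_f=\mathcal{O}_f^\times$, and $\chi_Q:K\to M_2(\mathbb{Q})$, $\chi_Q(x+y\sqrt{\Delta_0})=xI+\frac{2y}{f}SQ$. *)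

theory Defs
  imports
    "HOL-Analysis.Analysis"
    "HOL-Algebra.Elementary_Groups"
    "HOL-Computational_Algebra.Computational_Algebra"
begin

datatype bqf = BQF (coeff_xx: int) (coeff_xy: int) (coeff_yy: int)

definition forms :: "bqf set" where
  "forms = {Q. Gcd {coeff_xx Q, coeff_xy Q, coeff_yy Q} = 1}"

definition form_eval :: "bqf \<Rightarrow> real \<Rightarrow> real \<Rightarrow> real" where
  "form_eval Q x y =
     of_int (coeff_xx Q) * x\<^sup>2 + of_int (coeff_xy Q) * x * y + of_int (coeff_yy Q) * y\<^sup>2"

definition form_mat :: "bqf \<Rightarrow> real^2^2" where
  "form_mat Q = vector [vector [of_int (coeff_xx Q), of_int (coeff_xy Q) / 2],
                        vector [of_int (coeff_xy Q) / 2, of_int (coeff_yy Q)]]"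

definition discr :: "bqf \<Rightarrow> int" where
  "discr Q = (coeff_xy Q)\<^sup>2 - 4 * coeff_xx Q * coeff_yy Q"

(* The ring Q[x,y] is represented as Q[x][y]: the outer coefficients are those of
   1, y, y^2, each of them a polynomial in x. *)
definition form_poly :: "bqf \<Rightarrow> rat poly poly" where
  "form_poly Q = [:[:0, 0, of_int (coeff_xx Q):],
                  [:0, of_int (coeff_xy Q):],
                  [:of_int (coeff_yy Q):]:]"

lemma poly_form_poly:
  "poly (poly (form_poly Q) [:y:]) x =
     of_int (coeff_xx Q) * x\<^sup>2 + of_int (coeff_xy Q) * x * y + of_int (coeff_yy Q) * y\<^sup>2"
  by (simp add: form_poly_def algebra_simps power2_eq_square)

lemma form_eval_mat:
  "form_eval Q (v $ 1) (v $ 2) = inner v (form_mat Q *v v)"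
  by (simp add: form_eval_def form_mat_def inner_vec_def matrix_vector_mult_def sum_2 vector_2
      algebra_simps power2_eq_square)

definition indefinite :: "bqf \<Rightarrow> bool" where
  "indefinite Q \<longleftrightarrow> (\<exists>x y. form_eval Q x y > 0) \<and> (\<exists>x y. form_eval Q x y < 0)"

definition F_plus :: "bqf set" where
  "F_plus = {Q \<in> forms. indefinite Q \<and> Factorial_Ring.irreducible (form_poly Q)}"

definition F_minus :: "bqf set" where
  "F_minus = {Q \<in> forms. discr Q \<in> {-4, -3, 0, 1, 4}}"

(* GL_2(Z), regarded as a group of real matrices. *)
definition GL2Z :: "(real^2^2) monoid" where
  "GL2Z = \<lparr>carrier = map_matrix real_of_int ` {M. invertible M}, monoid.mult = (**), one = mat 1\<rparr>"

lemma group_GL2Z: "group GL2Z"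
proof -
  let ?h = "map_matrix real_of_int :: int^2^2 \<Rightarrow> real^2^2"
  have mul: "?h A ** ?h B = ?h (A ** B)" for A B
    by (simp add: vec_eq_iff matrix_matrix_mult_def)
  have one: "?h (mat 1) = mat 1"
    by (simp add: vec_eq_iff mat_def)
  have closed: "invertible (A ** B)" if "invertible A" "invertible B" for A B :: "int^2^2"
    using that by (rule invertible_mult)
  have inv1: "invertible (mat 1 :: int^2^2)"
    unfolding invertible_def by (intro exI[of _ "mat 1"]) simp
  show ?thesis
  proof (rule groupI)
    fix M N
    assume "M \<in> carrier GL2Z" "N \<in> carrier GL2Z"
    then show "M \<otimes>\<^bsub>GL2Z\<^esub> N \<in> carrier GL2Z"
      using closed by (auto simp: GL2Z_def mul)
  next
    show "\<one>\<^bsub>GL2Z\<^esub> \<in> carrier GL2Z"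
      using inv1 one by (force simp: GL2Z_def image_iff)
  next
    fix M assume "M \<in> carrier GL2Z"
    then obtain A B where A: "M = ?h A" and AB: "A ** B = mat 1" "B ** A = mat 1"
      by (auto simp: GL2Z_def invertible_def)
    then have "invertible B" unfolding invertible_def by blast
    then have "?h B \<in> carrier GL2Z" by (simp add: GL2Z_def)
    moreover have "?h B \<otimes>\<^bsub>GL2Z\<^esub> M = \<one>\<^bsub>GL2Z\<^esub>"
      by (simp add: GL2Z_def A mul AB one)
    ultimately show "\<exists>N\<in>carrier GL2Z. N \<otimes>\<^bsub>GL2Z\<^esub> M = \<one>\<^bsub>GL2Z\<^esub>" ..
  qed (auto simp: GL2Z_def matrix_mul_assoc)
qed

definition stab :: "bqf \<Rightarrow> (real^2^2) set" where
  "stab Q = {M \<in> carrier GL2Z. det M *\<^sub>R (transpose M ** form_mat Q ** M) = form_mat Q}"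

definition stab_group :: "bqf \<Rightarrow> (real^2^2) monoid" where
  "stab_group Q = GL2Z\<lparr>carrier := stab Q\<rparr>"

definition S_mat :: "real^2^2" where
  "S_mat = vector [vector [0, -1], vector [1, 0]]"

definition fund_discr :: "bqf \<Rightarrow> int" where
  "fund_discr Q = (let D = squarefree_part (discr Q) in if D mod 4 = 1 then D else 4 * D)"

definition conductor :: "bqf \<Rightarrow> real" where
  "conductor Q = sqrt (of_int (discr Q) / of_int (fund_discr Q))"

definition quad_order :: "bqf \<Rightarrow> real set" where
  "quad_order Q = {of_int m + of_int n * conductor Q * ((of_int (fund_discr Q) + sqrt (of_int (fund_discr Q))) / 2)
     | m n. True}"

definition order_units :: "bqf \<Rightarrow> real set" where
  "order_units Q = {u \<in> quad_order Q. \<exists>v \<in> quad_order Q. u * v = 1}"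

(* K is the subfield of the reals generated by the square root of fund_discr Q.  The pair (x, y)
   is unique, and chi Q meaningful, when that square root is irrational, as it is for all
   Q in F_plus. *)
definition chi :: "bqf \<Rightarrow> real \<Rightarrow> real^2^2" where
  "chi Q z = (THE A. \<exists>x\<in>\<rat>. \<exists>y\<in>\<rat>. z = x + y * sqrt (of_int (fund_discr Q)) \<and>
     A = x *\<^sub>R mat 1 + (2 * y / conductor Q) *\<^sub>R (S_mat ** form_mat Q))"

lemma chi_eq:
  assumes irr: "sqrt (of_int (fund_discr Q)) \<notin> \<rat>" and "x \<in> \<rat>" "y \<in> \<rat>"
  shows "chi Q (x + y * sqrt (of_int (fund_discr Q))) =
           x *\<^sub>R mat 1 + (2 * y / conductor Q) *\<^sub>R (S_mat ** form_mat Q)"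
proof -
  let ?s = "sqrt (of_int (fund_discr Q))"
  have uniq: "x' = x \<and> y' = y"
    if "x' \<in> \<rat>" "y' \<in> \<rat>" "x + y * ?s = x' + y' * ?s" for x' y'
  proof -
    have eq: "(y - y') * ?s = x' - x"
      using that by (simp add: algebra_simps)
    have "y = y'"
    proof (rule ccontr)
      assume "y \<noteq> y'"
      then have "?s = (x' - x) / (y - y')"
        using eq by (simp add: field_simps)
      moreover have "(x' - x) / (y - y') \<in> \<rat>"
        using assms that by (intro Rats_divide Rats_diff)
      ultimately show False using irr by simp
    qed
    with eq show ?thesis by simp
  qed
  show ?thesis
    unfolding chi_def by (rule the_equality) (use assms uniq in blast)+
qed

end

theory Submission
  imports Defs
begin

text \<open>
  A matrix of determinant \<open>\<plusminus>1\<close> stabilises \<open>Q\<close> iff it commutes with \<open>SQ\<close>, and the commutant of \<open>SQ\<close>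
  consists of the matrices \<open>(t/2) I + u SQ\<close>. As the coefficients of \<open>Q\<close> are coprime, integrality forces
  \<open>t\<close> and \<open>u\<close> to be integers, and the determinant is \<open>(t\<^sup>2 - \<Delta>u\<^sup>2)/4\<close>. So the stability group is
  the solution set of \<open>t\<^sup>2 - \<Delta>u\<^sup>2 = \<plusminus>4\<close>, multiplied like the numbers \<open>(t + u\<surd>\<Delta>)/2\<close>. For \<open>\<Delta> < 0\<close>, \<open>\<Delta> = 0\<close>
  and square \<open>\<Delta>\<close> the equation is solved directly. For positive nonsquare \<open>\<Delta>\<close> the solutions are the units
  of the order of discriminant \<open>\<Delta>\<close>; Dirichlet approximation and the pigeonhole principle give a
  nontrivial one, the units in a bounded interval \<open>(1, C]\<close> are finitely many, and the least unit
  \<open>> 1\<close> generates all of them up to sign.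
\<close>

no_notation fps_nth (infixl "$" 75)

section \<open>Groups generated by one or two elements\<close>

text \<open>The case \<open>k = 0\<close> is included: the hypothesis on \<open>x\<close> is then
  void and \<open>i mod 0 = i\<close>. This lets \<open>integer_mod_group 0\<close>, the group of
  integers, be treated together with the finite cyclic groups.\<close>

lemma (in group) int_pow_mod:
  assumes "x \<in> carrier G" and "x [^] k = \<one>"
  shows "x [^] (i mod int k) = x [^] i"
proof -
  have "x [^] i = x [^] (int k * (i div int k) + i mod int k)"
    by simp
  also have "\<dots> = (x [^] int k) [^] (i div int k) \<otimes> x [^] (i mod int k)"
    using assms(1) by (simp only: int_pow_mult int_pow_pow)
  finally show ?thesis
    using assms by (simp add: int_pow_int)
qed

lemma (in group) integer_mod_group_pow_hom:
  assumes "x \<in> carrier G" and "x [^] k = \<one>"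
  shows "(\<lambda>i. x [^] i) \<in> hom (integer_mod_group k) G"
  using assms by (intro homI) (simp_all add: int_pow_mod int_pow_mult)

lemma mod_in_integer_mod_group: "i mod int k \<in> carrier (integer_mod_group k)"
  by (simp add: carrier_integer_mod_group)

lemma (in group_hom) is_isoI_trivial_kernel:
  assumes "\<And>x. x \<in> carrier G \<Longrightarrow> h x = \<one>\<^bsub>H\<^esub> \<Longrightarrow> x = \<one>"
    and "carrier H \<subseteq> h ` carrier G"
  shows "H \<cong> G"
proof -
  have "kernel G H h = {\<one>}"
    using assms(1) by (auto simp: kernel_def)
  then have "inj_on h (carrier G)"
    by (simp add: inj_iff_trivial_ker)
  then have "h \<in> iso G H"
    using assms(2) homh by (auto simp: Group.iso_iff)
  then show ?thesis
    using is_isoI G.iso_sym by blast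
qed

lemma (in group) iso_integer_mod_group:
  assumes "x \<in> carrier G" and "x [^] k = \<one>"
    and gen: "carrier G \<subseteq> range (\<lambda>i::int. x [^] i)"
    and triv: "\<And>i. i \<in> carrier (integer_mod_group k) \<Longrightarrow> x [^] i = \<one> \<Longrightarrow> i = 0"
  shows "G \<cong> integer_mod_group k"
proof -
  interpret h: group_hom "integer_mod_group k" G "\<lambda>i. x [^] i"
    using integer_mod_group_pow_hom[OF assms(1,2)]
    by (simp add: group_hom_def group_hom_axioms_def is_group)
  have "y \<in> (\<lambda>i. x [^] i) ` carrier (integer_mod_group k)" if "y \<in> carrier G" for y
  proof -
    obtain i :: int where "y = x [^] i"
      using gen \<open>y \<in> carrier G\<close> by blast
    then have "y = x [^] (i mod int k)"
      using assms by (simp add: int_pow_mod)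
    then show ?thesis
      using mod_in_integer_mod_group by blast
  qed
  then show ?thesis
    using triv by (intro h.is_isoI_trivial_kernel) auto
qed

text \<open>Commutativity makes (i, j) \<mapsto> \<open>x [^] i \<otimes> y [^] j\<close> a
  homomorphism, and \<open>int_pow_mod\<close> makes it compatible with reduction of the exponents.
  With \<open>l = 0\<close> the second factor is infinite cyclic.\<close>

lemma (in comm_group) iso_integer_mod_group_Times:
  assumes x: "x \<in> carrier G" "x [^] k = \<one>" and y: "y \<in> carrier G" "y [^] l = \<one>"
    and gen: "\<And>g. g \<in> carrier G \<Longrightarrow> \<exists>(i::int) (j::int). g = x [^] i \<otimes> y [^] j"
    and triv: "\<And>i j. i \<in> carrier (integer_mod_group k) \<Longrightarrow> j \<in> carrier (integer_mod_group l) \<Longrightarrow>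
                 x [^] i \<otimes> y [^] j = \<one> \<Longrightarrow> i = 0 \<and> j = 0"
  shows "G \<cong> integer_mod_group k \<times>\<times> integer_mod_group l"
proof -
  let ?h = "\<lambda>(i::int, j::int). x [^] i \<otimes> y [^] j"
  let ?Z = "integer_mod_group k \<times>\<times> integer_mod_group l"
  have Z: "group ?Z"
    by (simp add: DirProd_group)
  have "?h \<in> hom ?Z G"
    using x y by (intro homI) (auto simp: int_pow_mod int_pow_mult m_ac)
  then interpret h: group_hom ?Z G ?h
    using Z by (simp add: group_hom_def group_hom_axioms_def is_group)
  have "g \<in> ?h ` carrier ?Z" if g: "g \<in> carrier G" for g
  proof -
    obtain i j :: int where "g = x [^] i \<otimes> y [^] j"
      using gen[OF g] by blast
    then have "g = ?h (i mod int k, j mod int l)"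
      using x y by (simp add: int_pow_mod)
    then show ?thesis
      using mod_in_integer_mod_group by (metis (no_types, lifting) DirProd_def SigmaI image_eqI partial_object.select_convs(1))
  qed
  then show ?thesis
    using triv by (intro h.is_isoI_trivial_kernel) auto
qed

lemma (in comm_group) carrier_eq_generate_pair:
  assumes "x \<in> carrier G" "y \<in> carrier G"
    and "\<And>g. g \<in> carrier G \<Longrightarrow> \<exists>(i::int) (j::int). g = x [^] i \<otimes> y [^] j"
  shows "carrier G = generate G {x, y}"
proof
  have "subgroup (generate G {x, y}) G"
    using assms by (intro generate_is_subgroup) auto
  then show "carrier G \<subseteq> generate G {x, y}"
    using assms(3) by (fastforce intro: subgroup_int_pow_closed subgroup.m_closed generate.incl)
  show "generate G {x, y} \<subseteq> carrier G"
    using assms by (intro generate_incl) auto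
qed

section \<open>The stability group as the solutions of Pell's equation\<close>

text \<open>The matrix SQ has trace 0 and determinant -\<Delta>/4, so (SQ)^2 = (\<Delta>/4) I. Hence
  SQ plays the role of \<surd>\<Delta>/2.\<close>

definition stab_elt :: "bqf \<Rightarrow> int \<Rightarrow> int \<Rightarrow> real^2^2" where
  "stab_elt Q t u = (of_int t / 2) *\<^sub>R mat 1 + of_int u *\<^sub>R (S_mat ** form_mat Q)"

lemma stab_elt_nth:
  "stab_elt Q t u $ 1 $ 1 = (of_int t - of_int u * of_int (coeff_xy Q)) / 2"
  "stab_elt Q t u $ 1 $ 2 = - of_int u * of_int (coeff_yy Q)"
  "stab_elt Q t u $ 2 $ 1 = of_int u * of_int (coeff_xx Q)"
  "stab_elt Q t u $ 2 $ 2 = (of_int t + of_int u * of_int (coeff_xy Q)) / 2"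
  by (simp_all add: stab_elt_def S_mat_def form_mat_def mat_def matrix_matrix_mult_def sum_2
      vector_2 field_simps)

lemma mat2_eq_iff:
  "(A :: 'a^2^2) = B \<longleftrightarrow> A $ 1 $ 1 = B $ 1 $ 1 \<and> A $ 1 $ 2 = B $ 1 $ 2 \<and>
     A $ 2 $ 1 = B $ 2 $ 1 \<and> A $ 2 $ 2 = B $ 2 $ 2"
  by (simp add: vec_eq_iff forall_2 conj_assoc)

lemma mat1_eq_stab_elt: "mat 1 = stab_elt Q 2 0"
  and minus_mat1_eq_stab_elt: "- mat 1 = stab_elt Q (-2) 0"
  by (simp_all add: stab_elt_def)

text \<open>This is the product of (t + u\<surd>\<Delta>)/2 and (t' + u'\<surd>\<Delta>)/2. The
  hypotheses are doubled in order to stay within the integers; that the halves exist is a matter of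
  parity, settled in \<open>pell_mult_closed\<close>.\<close>

lemma stab_elt_mult:
  assumes "2 * t'' = t * t' + discr Q * u * u'" "2 * u'' = t * u' + t' * u"
  shows "stab_elt Q t u ** stab_elt Q t' u' = stab_elt Q t'' u''"
proof -
  have t: "real_of_int t'' = (of_int t * of_int t' + of_int (discr Q) * of_int u * of_int u') / 2"
    using arg_cong[OF assms(1), of real_of_int] by simp
  have u: "real_of_int u'' = (of_int t * of_int u' + of_int t' * of_int u) / 2"
    using arg_cong[OF assms(2), of real_of_int] by simp
  show ?thesis
    unfolding mat2_eq_iff
    by (simp add: matrix_matrix_mult_def sum_2 stab_elt_nth t u discr_def field_simps power2_eq_square)
qed

text \<open>Coprimality enters only through this identity: it recovers an integer u from the
  products ua, ub, uc, which are what the entries of a matrix give.\<close>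

lemma forms_bezout:
  assumes "Q \<in> forms"
  obtains \<alpha> \<beta> \<gamma> where "\<alpha> * coeff_xx Q + \<beta> * coeff_xy Q + \<gamma> * coeff_yy Q = 1"
proof -
  obtain x y where xy: "x * coeff_xy Q + y * coeff_yy Q = gcd (coeff_xy Q) (coeff_yy Q)"
    using bezout_int by blast
  obtain v w where "v * coeff_xx Q + w * gcd (coeff_xy Q) (coeff_yy Q)
      = gcd (coeff_xx Q) (gcd (coeff_xy Q) (coeff_yy Q))"
    using bezout_int by blast
  also have "\<dots> = 1"
    using assms by (simp add: forms_def)
  finally have "v * coeff_xx Q + (w * x) * coeff_xy Q + (w * y) * coeff_yy Q = 1"
    by (simp add: xy[symmetric] algebra_simps)
  then show thesis ..
qed

lemma stab_elt_eq_iff: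
  assumes "Q \<in> forms"
  shows "stab_elt Q t u = stab_elt Q t' u' \<longleftrightarrow> t = t' \<and> u = u'"
proof
  assume eq: "stab_elt Q t u = stab_elt Q t' u'"
  obtain \<alpha> \<beta> \<gamma> where bez: "\<alpha> * coeff_xx Q + \<beta> * coeff_xy Q + \<gamma> * coeff_yy Q = 1"
    using forms_bezout[OF assms] .
  note nth = arg_cong[OF eq, of "\<lambda>A. A $ i $ j" for i j]
  have "of_int t - of_int u * of_int (coeff_xy Q) = of_int t' - of_int u' * real_of_int (coeff_xy Q)"
       "of_int t + of_int u * of_int (coeff_xy Q) = of_int t' + of_int u' * real_of_int (coeff_xy Q)"
    using nth[of 1 1] nth[of 2 2] unfolding stab_elt_nth by simp_all
  then have "real_of_int (u * coeff_xx Q) = of_int (u' * coeff_xx Q)"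
       "real_of_int (u * coeff_yy Q) = of_int (u' * coeff_yy Q)"
       "real_of_int (u * coeff_xy Q) = of_int (u' * coeff_xy Q)"
       "real_of_int t = of_int t'"
    using nth[of 1 2] nth[of 2 1]
    unfolding stab_elt_nth of_int_mult by linarith+
  then have t: "t = t'" and "u * coeff_xx Q = u' * coeff_xx Q" "u * coeff_yy Q = u' * coeff_yy Q"
      "u * coeff_xy Q = u' * coeff_xy Q"
    by (simp_all only: of_int_eq_iff)
  with bez show "t = t' \<and> u = u'"
    by auto
qed auto

lemma det_map_matrix_of_int:
  "det (map_matrix real_of_int (N :: int^2^2)) = of_int (det N)"
  by (simp add: det_2)

lemma det_invertible_int:
  fixes N :: "int^2^2"
  assumes "invertible N"
  shows "det N = 1 \<or> det N = -1"
proof -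
  obtain N' where "N ** N' = mat 1"
    using assms invertible_def by blast
  then have "det N * det N' = 1"
    by (metis det_I det_mul)
  then show ?thesis
    using zmult_eq_1_iff by blast
qed

text \<open>A determinant \<plusminus>1 is its own inverse, so the inverse matrix is det N times the
  adjugate.\<close>

lemma invertible_int_matI:
  fixes N :: "int^2^2"
  assumes "det N = 1 \<or> det N = -1"
  shows "invertible N"
proof -
  let ?A = "vector [vector [det N * N$2$2, - det N * N$1$2],
    vector [- det N * N$2$1, det N * N$1$1]] :: int^2^2"
  have "N$1$1 * N$2$2 - N$1$2 * N$2$1 = det N"
    by (simp add: det_2)
  with assms have "N ** ?A = mat 1 \<and> ?A ** N = mat 1"
    unfolding mat2_eq_iff
    by (elim disjE) (simp_all add: matrix_matrix_mult_def sum_2 mat_def mult.commute)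
  then show ?thesis
    unfolding invertible_def by blast
qed

lemma carrier_GL2Z: "carrier GL2Z = map_matrix real_of_int ` {N. invertible N}"
  by (simp add: GL2Z_def)

text \<open>The three equations on the right spell out that M commutes with SQ. They are equivalent
  to invariance because M^T S M = det(M) S and det(M)^2 = 1.\<close>

lemma stab_transform:
  fixes M :: "real^2^2"
  assumes "det M = 1 \<or> det M = -1"
  shows "det M *\<^sub>R (transpose M ** form_mat Q ** M) = form_mat Q \<longleftrightarrow>
    of_int (coeff_xx Q) * (M$2$2 - M$1$1) = of_int (coeff_xy Q) * M$2$1 \<and>
    of_int (coeff_yy Q) * (M$1$1 - M$2$2) = of_int (coeff_xy Q) * M$1$2 \<and>
    of_int (coeff_xx Q) * M$1$2 = - of_int (coeff_yy Q) * M$2$1" (is "?l \<longleftrightarrow> ?r")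
proof -
  define p q r s where "p = M$1$1" and "q = M$1$2" and "r = M$2$1" and "s = M$2$2"
  define a b c where "a = real_of_int (coeff_xx Q)" and "b = real_of_int (coeff_xy Q)"
    and "c = real_of_int (coeff_yy Q)"
  note defs = p_def q_def r_def s_def a_def b_def c_def
  define e where "e = det M"
  have e: "e = p * s - q * r" "e * e = 1"
    using assms by (auto simp: e_def det_2 defs)
  have "?l \<longleftrightarrow> e * (a * p^2 + b * p * r + c * r^2) = a \<and>
      e * (2 * a * p * q + b * (p * s + q * r) + 2 * c * r * s) = b \<and>
      e * (a * q^2 + b * q * s + c * s^2) = c"
    unfolding mat2_eq_iff
    by (auto simp: matrix_matrix_mult_def sum_2 vector_2 form_mat_def transpose_def
          power2_eq_square algebra_simps simp flip: defs e_def)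
  also have "\<dots> \<longleftrightarrow> a * (s - p) = b * r \<and> c * (p - s) = b * q \<and> a * q = - c * r" (is "?A \<longleftrightarrow> ?B")
  proof
    assume ?A
    then have A: "e * a = a * p^2 + b * p * r + c * r^2"
        "e * b = 2 * a * p * q + b * (p * s + q * r) + 2 * c * r * s"
        "e * c = a * q^2 + b * q * s + c * s^2"
      using e(2) by (metis mult.assoc mult_1)+
    \<comment> \<open>Multiplying the invariance by the adjugate of M on the right gives Q adj(M) =
      M^T Q, which is linear in M. These are its doubled entries, times e so that \<open>A\<close>
      applies to ea, eb and ec.\<close>
    have "e * (2 * a * s - b * r) = e * (2 * p * a + r * b)"
      "e * (b * p - 2 * a * q) = e * (p * b + 2 * r * c)"
      "e * (2 * c * p - b * q) = e * (q * b + 2 * s * c)"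
      unfolding right_diff_distrib mult.assoc[symmetric] mult.commute[of e 2]
      unfolding mult.assoc[of 2 e] A
      unfolding e(1) by (simp_all add: algebra_simps power2_eq_square)
    moreover have "e \<noteq> 0"
      using e(2) by auto
    ultimately have "2 * a * s - b * r = 2 * p * a + r * b"
      "b * p - 2 * a * q = p * b + 2 * r * c"
      "2 * c * p - b * q = q * b + 2 * s * c"
      by (simp_all only: mult_cancel_left) auto
    then show ?B
      by (simp add: algebra_simps)
  next
    assume B: ?B
    have "a * p^2 + b * p * r + c * r^2 = e * a"
      using B e(1) by algebra
    moreover have "2 * a * p * q + b * (p * s + q * r) + 2 * c * r * s = e * b"
      using B e(1) by algebra
    moreover have "a * q^2 + b * q * s + c * s^2 = e * c"
      using B e(1) by algebra
    ultimately show ?A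
      using e(2) by (simp flip: mult.assoc)
  qed
  finally show ?thesis
    by (simp add: defs)
qed

lemma stab_eq:
  assumes "Q \<in> forms"
  shows "stab Q = {stab_elt Q t u | t u. t\<^sup>2 - discr Q * u\<^sup>2 \<in> {4, -4}}"
proof (intro equalityI subsetI)
  fix M assume M: "M \<in> stab Q"
  then obtain N :: "int^2^2" where N: "M = map_matrix real_of_int N" "invertible N"
    by (auto simp: stab_def carrier_GL2Z)
  define p q r s where "p = N$1$1" and "q = N$1$2" and "r = N$2$1" and "s = N$2$2"
  define a b c where "a = coeff_xx Q" and "b = coeff_xy Q" and "c = coeff_yy Q"
  note defs = p_def q_def r_def s_def a_def b_def c_def
  have d: "det N = 1 \<or> det N = -1"
    using N det_invertible_int by blast
  then have "det M = 1 \<or> det M = -1"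
    by (auto simp: N det_map_matrix_of_int)
  with M have "real_of_int (a * (s - p)) = of_int (b * r)" "real_of_int (c * (p - s)) = of_int (b * q)"
      "real_of_int (a * q) = of_int (- c * r)"
    by (auto simp: stab_def stab_transform N defs)
  then have eqs: "a * (s - p) = b * r" "c * (p - s) = b * q" "a * q = - c * r"
    by (simp_all only: of_int_eq_iff)
  obtain \<alpha> \<beta> \<gamma> where bez: "\<alpha> * a + \<beta> * b + \<gamma> * c = 1"
    using forms_bezout[OF assms] unfolding defs .
  \<comment> \<open>The relations make (r, s - p, -q) proportional to (a, b, c). The Bezout
    combination of its components is the factor, which is therefore an integer.\<close>
  define u where "u = \<alpha> * r + \<beta> * (s - p) - \<gamma> * q"
  have u: "u * a = r" "u * c = - q" "u * b = s - p"
    using eqs bez unfolding u_def by algebra+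
  have "(p + s)\<^sup>2 - (b\<^sup>2 - 4 * a * c) * u\<^sup>2 = (p + s)\<^sup>2 - (u * b)\<^sup>2 + 4 * (u * a) * (u * c)"
    by (simp add: power2_eq_square algebra_simps)
  then have "(p + s)\<^sup>2 - discr Q * u\<^sup>2 = 4 * (p * s - q * r)"
    unfolding discr_def a_def[symmetric] b_def[symmetric] c_def[symmetric]
    unfolding u
    by (simp add: power2_eq_square algebra_simps)
  also have "p * s - q * r = det N"
    by (simp add: det_2 defs)
  finally have *: "(p + s)\<^sup>2 - discr Q * u\<^sup>2 \<in> {4, -4}"
    using d by auto
  have "M = stab_elt Q (p + s) u"
    unfolding mat2_eq_iff stab_elt_nth
    using arg_cong[OF u(1), of real_of_int] arg_cong[OF u(2), of real_of_int]
      arg_cong[OF u(3), of real_of_int]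
    by (simp add: N defs)
  with * show "M \<in> {stab_elt Q t u | t u. t\<^sup>2 - discr Q * u\<^sup>2 \<in> {4, -4}}"
    by blast
next
  fix M assume "M \<in> {stab_elt Q t u | t u. t\<^sup>2 - discr Q * u\<^sup>2 \<in> {4, -4}}"
  then obtain t u where M: "M = stab_elt Q t u" and tu: "t\<^sup>2 - discr Q * u\<^sup>2 \<in> {4, -4}"
    by blast
  define b where "b = coeff_xy Q"
  have "even x" if "x \<in> {4, -4}" for x :: int
    using that by auto
  \<comment> \<open>Modulo 2, t^2 - \<Delta>u^2 is t - ub because \<Delta> is congruent to b^2. So
    the diagonal entries (t - ub)/2 and (t + ub)/2 are integers.\<close>
  from this[OF tu] have "even (t - u * b)"
    by (auto simp: discr_def b_def)
  then obtain p where p: "t - u * b = 2 * p"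
    by (elim evenE)
  define N :: "int^2^2" where
    "N = vector [vector [p, - u * coeff_yy Q], vector [u * coeff_xx Q, p + u * b]]"
  have "4 * det N = t\<^sup>2 - discr Q * u\<^sup>2"
    using p by (simp add: N_def det_2 vector_2 discr_def flip: b_def) algebra
  then have d: "det N = 1 \<or> det N = -1"
    using tu by auto
  have MN: "M = map_matrix real_of_int N"
    unfolding mat2_eq_iff M stab_elt_nth
    using arg_cong[OF p, of real_of_int] by (simp add: N_def vector_2 b_def)
  have "M \<in> carrier GL2Z"
    using invertible_int_matI[OF d] MN by (simp add: carrier_GL2Z)
  moreover have "det M = 1 \<or> det M = -1"
    using d by (auto simp: MN det_map_matrix_of_int)
  ultimately show "M \<in> stab Q"
    by (simp add: stab_def stab_transform) (simp add: M stab_elt_nth field_simps)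
qed

lemma stab_elt_in_stab_iff:
  assumes "Q \<in> forms"
  shows "stab_elt Q t u \<in> stab Q \<longleftrightarrow> t\<^sup>2 - discr Q * u\<^sup>2 \<in> {4, -4}"
  using assms by (force simp: stab_eq stab_elt_eq_iff)

lemma stabE:
  assumes "Q \<in> forms" "M \<in> stab Q"
  obtains t u where "M = stab_elt Q t u" "t\<^sup>2 - discr Q * u\<^sup>2 \<in> {4, -4}"
  using assms stab_eq by auto

text \<open>The norm (t^2 - du^2)/4 is multiplicative. An even t^2 - du^2 makes t congruent to du
  modulo 2, so both doubled coordinates of the product are even.\<close>

lemma pell_mult_closed:
  fixes t u t' u' d :: int
  assumes "t\<^sup>2 - d * u\<^sup>2 \<in> {4, -4}" "t'\<^sup>2 - d * u'\<^sup>2 \<in> {4, -4}"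
  obtains t'' u'' where "2 * t'' = t * t' + d * u * u'" "2 * u'' = t * u' + t' * u"
    "t''\<^sup>2 - d * u''\<^sup>2 \<in> {4, -4}"
proof -
  have "even x" if "x \<in> {4, -4}" for x :: int
    using that by auto
  from this[OF assms(1)] this[OF assms(2)]
  have par: "even t \<longleftrightarrow> even (d * u)" "even t' \<longleftrightarrow> even (d * u')"
    by auto
  have "even (t * t' + d * u * u')"
    using par by auto
  then obtain t'' where t: "t * t' + d * u * u' = 2 * t''" by (elim evenE)
  have "even (t * u' + t' * u)"
    using par by auto
  then obtain u'' where u: "t * u' + t' * u = 2 * u''" by (elim evenE)
  have "(t\<^sup>2 - d * u\<^sup>2) * (t'\<^sup>2 - d * u'\<^sup>2) = 4 * (t''\<^sup>2 - d * u''\<^sup>2)"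
    using t u by algebra
  then have "t''\<^sup>2 - d * u''\<^sup>2 \<in> {4, -4}"
    using assms by auto
  with t u that show thesis by metis
qed

lemma stab_mult_closed:
  assumes "Q \<in> forms" "A \<in> stab Q" "B \<in> stab Q"
  shows "A ** B \<in> stab Q"
proof -
  obtain t u t' u' where A: "A = stab_elt Q t u" "t\<^sup>2 - discr Q * u\<^sup>2 \<in> {4, -4}"
      and B: "B = stab_elt Q t' u'" "t'\<^sup>2 - discr Q * u'\<^sup>2 \<in> {4, -4}"
    using assms stab_eq by auto
  obtain t'' u'' where "2 * t'' = t * t' + discr Q * u * u'" "2 * u'' = t * u' + t' * u"
    "t''\<^sup>2 - discr Q * u''\<^sup>2 \<in> {4, -4}"
    using pell_mult_closed A B by metis
  then show ?thesis
    using A B stab_elt_mult stab_eq[OF assms(1)] by blast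
qed

lemma subgroup_stab:
  assumes "Q \<in> forms"
  shows "subgroup (stab Q) GL2Z"
proof (rule group.subgroupI[OF group_GL2Z])
  show "stab Q \<subseteq> carrier GL2Z"
    by (auto simp: stab_def)
  have "stab_elt Q 2 0 \<in> stab Q"
    unfolding stab_eq[OF assms] by force
  then show "stab Q \<noteq> {}" by blast
  show "A \<otimes>\<^bsub>GL2Z\<^esub> B \<in> stab Q" if "A \<in> stab Q" "B \<in> stab Q" for A B
    using stab_mult_closed[OF assms that] by (simp add: GL2Z_def)
  fix A assume A: "A \<in> stab Q"
  then obtain t u where tu: "A = stab_elt Q t u" "t\<^sup>2 - discr Q * u\<^sup>2 \<in> {4, -4}"
    using assms stab_eq by auto
  \<comment> \<open>For norm e = \<plusminus>1 the inverse is e times the conjugate, that is (et,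
    -eu).\<close>
  define e where "e = (if t\<^sup>2 - discr Q * u\<^sup>2 = 4 then 1 else -1 :: int)"
  have e: "e * (t\<^sup>2 - discr Q * u\<^sup>2) = 4" "e = 1 \<or> e = -1"
    using tu by (auto simp: e_def)
  have "(e * t)\<^sup>2 - discr Q * (- e * u)\<^sup>2 = t\<^sup>2 - discr Q * u\<^sup>2"
    using e(2) by auto
  then have B: "stab_elt Q (e * t) (- e * u) \<in> stab Q"
    using tu(2) by (simp only: stab_elt_in_stab_iff[OF assms])
  have "stab_elt Q (e * t) (- e * u) ** A = mat 1"
    unfolding tu(1) mat1_eq_stab_elt[of Q]
    by (rule stab_elt_mult) (use e(1) in \<open>simp_all add: power2_eq_square algebra_simps\<close>)
  then have "inv\<^bsub>GL2Z\<^esub> A = stab_elt Q (e * t) (- e * u)"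
    using A B by (intro group.inv_equality[OF group_GL2Z]) (auto simp: GL2Z_def stab_def)
  with B show "inv\<^bsub>GL2Z\<^esub> A \<in> stab Q" by simp
qed

lemma stab_group_simps [simp]:
  "carrier (stab_group Q) = stab Q" "A \<otimes>\<^bsub>stab_group Q\<^esub> B = A ** B" "\<one>\<^bsub>stab_group Q\<^esub> = mat 1"
  by (simp_all add: stab_group_def GL2Z_def)

lemma comm_group_stab_group:
  assumes "Q \<in> forms"
  shows "comm_group (stab_group Q)"
proof (rule group.group_comm_groupI)
  show "group (stab_group Q)"
    unfolding stab_group_def using group.subgroup_imp_group[OF group_GL2Z subgroup_stab[OF assms]] .
  fix A B assume "A \<in> carrier (stab_group Q)" "B \<in> carrier (stab_group Q)"
  then obtain t u t' u' where AB: "A = stab_elt Q t u" "B = stab_elt Q t' u'"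
    using stabE[OF assms] by (metis stab_group_simps(1))
  show "A \<otimes>\<^bsub>stab_group Q\<^esub> B = B \<otimes>\<^bsub>stab_group Q\<^esub> A"
    unfolding stab_group_simps AB mat2_eq_iff
    by (simp add: matrix_matrix_mult_def sum_2 stab_elt_nth field_simps)
qed

section \<open>Irreducible indefinite forms\<close>

text \<open>A rational square root of an integer is an integer. The field is left general because
  the fact is applied both to rational and to real numbers.\<close>

lemma Rats_square_eq_of_int:
  fixes r :: "'a :: field_char_0"
  assumes "r \<in> \<rat>" "r\<^sup>2 = of_int d"
  shows "\<exists>k. d = k\<^sup>2"
proof -
  obtain a b :: int where "b > 0" and r: "r = of_int a / of_int b"
    using assms(1) by (rule Rats_cases')
  have "(of_int (a\<^sup>2) :: 'a) = of_int (d * b\<^sup>2)"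
    using assms(2) \<open>b > 0\<close> by (simp add: r field_simps)
  then have ab: "a\<^sup>2 = d * b\<^sup>2"
    by (simp only: of_int_eq_iff)
  then have "b dvd a"
    by (metis dvd_triv_right pow_divides_pow_iff zero_less_numeral)
  then obtain k where "a = b * k" ..
  with ab \<open>b > 0\<close> have "d = k\<^sup>2"
    by (simp add: power_mult_distrib)
  then show ?thesis ..
qed

lemma irreducible_form_poly_imp_discr_nonsquare:
  assumes "Factorial_Ring.irreducible (form_poly Q)"
  shows "\<nexists>k. discr Q = k\<^sup>2"
proof
  assume "\<exists>k. discr Q = k\<^sup>2"
  then obtain k where k: "discr Q = k\<^sup>2" ..
  define a b c d :: rat where "a = of_int (coeff_xx Q)" and "b = of_int (coeff_xy Q)"
    and "c = of_int (coeff_yy Q)" and "d = of_int k"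
  note defs = a_def b_def c_def d_def
  have disc: "b\<^sup>2 - 4 * a * c = d\<^sup>2"
    using arg_cong[OF k, of "of_int :: int \<Rightarrow> rat"] by (simp add: discr_def defs)
  have f: "form_poly Q = [:[:0, 0, a:], [:0, b:], [:c:]:]"
    by (simp add: form_poly_def defs)
  show False
  proof (cases "a = 0")
    case True
    then have "form_poly Q = [:0, 1:] * [:[:0, b:], [:c:]:]"
      by (simp add: f)
    then have "is_unit [:[:0, b:], [:c:]:]"
      using irreducibleD[OF assms] by (fastforce simp: is_unit_poly_iff)
    then have "b = 0" "c = 0"
      by (auto simp: is_unit_poly_iff split: if_splits)
    with True f assms show False
      by simp
  next
    case False
    \<comment> \<open>This is 4aQ = (2ax + (b - d)y)(2ax + (b + d)y), with the factor 4a divided out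
      of the second factor.\<close>
    have "form_poly Q = [:[:0, 2 * a:], [:b - d:]:] * [:[:0, 1 / 2:], [:(b + d) / (4 * a):]:]"
      using False disc by (simp add: f field_simps power2_eq_square)
    then have "is_unit [:[:0, 2 * a:], [:b - d:]:] \<or> is_unit [:[:0, 1 / 2:], [:(b + d) / (4 * a):]:]"
      by (rule irreducibleD[OF assms])
    with False show False
      by (auto simp: is_unit_poly_iff split: if_splits)
  qed
qed

text \<open>Here c is nonzero, so in any factorisation the leading coefficients in y divide the unit
  c. A factor of degree 0 in y is therefore a unit. If both factors are linear in y, setting x = 1
  gives a rational root y of a + by + cy^2, and then \<Delta> = (2cy + b)^2 is a square.\<close>

lemma discr_nonsquare_imp_irreducible_form_poly:
  assumes "\<nexists>k. discr Q = k\<^sup>2"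
  shows "Factorial_Ring.irreducible (form_poly Q)"
proof (rule irreducibleI)
  define a b c :: rat where "a = of_int (coeff_xx Q)" and "b = of_int (coeff_xy Q)"
    and "c = of_int (coeff_yy Q)"
  note defs = a_def b_def c_def
  have f: "form_poly Q = [:[:0, 0, a:], [:0, b:], [:c:]:]"
    by (simp add: form_poly_def defs)
  have c: "c \<noteq> 0"
    using assms by (auto simp: discr_def c_def)
  show "form_poly Q \<noteq> 0" "\<not> is_unit (form_poly Q)"
    using c by (auto simp: f is_unit_poly_iff)
  have no_const: "is_unit A" if AB: "form_poly Q = A * B" and deg: "degree A = 0" for A B
  proof -
    obtain \<alpha> where A: "A = [:\<alpha>:]"
      using deg degree_eq_zeroE by blast
    have "poly.coeff (form_poly Q) 2 = [:c:]"
      by (simp add: f numeral_2_eq_2)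
    then have "\<alpha> * poly.coeff B 2 = [:c:]"
      using AB by (simp add: A)
    then have "\<alpha> dvd [:c:]"
      by (metis dvd_triv_left)
    moreover have "is_unit [:c:]"
      using c by (simp add: is_unit_const_poly_iff dvd_field_iff)
    ultimately have "is_unit \<alpha>"
      using dvd_trans by blast
    then show ?thesis
      by (simp add: A is_unit_const_poly_iff)
  qed
  fix A B assume AB: "form_poly Q = A * B"
  have "degree (form_poly Q) = 2"
    using c by (simp add: f)
  moreover have "A \<noteq> 0" "B \<noteq> 0"
    using AB \<open>form_poly Q \<noteq> 0\<close> by auto
  ultimately have deg: "degree A + degree B = 2"
    using AB by (simp add: degree_mult_eq)
  show "is_unit A \<or> is_unit B"
  proof (rule ccontr)
    assume "\<not> (is_unit A \<or> is_unit B)"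
    with no_const[of A B] no_const[of B A] AB have "degree A \<noteq> 0" "degree B \<noteq> 0"
      by (auto simp: mult.commute)
    with deg have "degree A = 1" "degree B = 1"
      by auto
    then have Aeq: "A = [:poly.coeff A 0, poly.coeff A 1:]" and Beq: "B = [:poly.coeff B 0, poly.coeff B 1:]"
      by (auto intro!: poly_eqI simp: coeff_pCons coeff_eq_0 split: nat.split)
    have "poly.coeff (form_poly Q) 2 = poly.coeff A 1 * poly.coeff B 1"
      unfolding AB by (subst Aeq, subst Beq) (simp add: numeral_2_eq_2)
    then have lead: "poly.coeff A 1 * poly.coeff B 1 = [:c:]"
      by (simp add: f numeral_2_eq_2)
    then have "poly.coeff A 1 dvd [:c:]"
      by (metis dvd_triv_left)
    moreover have "is_unit [:c:]"
      using c by (simp add: is_unit_const_poly_iff dvd_field_iff)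
    ultimately have "is_unit (poly.coeff A 1)"
      using dvd_trans by blast
    then obtain \<alpha> where \<alpha>: "poly.coeff A 1 = [:\<alpha>:]" "\<alpha> \<noteq> 0"
      by (auto simp: is_unit_poly_iff dvd_field_iff)
    define y where "y = - poly (poly.coeff A 0) 1 / \<alpha>"
    have "poly (poly A [:y:]) 1 = 0"
      using \<alpha> by (subst Aeq) (simp add: y_def)
    then have "poly (poly (form_poly Q) [:y:]) 1 = 0"
      by (simp add: AB)
    then have "a + b * y + c * y\<^sup>2 = 0"
      by (simp add: poly_form_poly defs)
    then have "(2 * c * y + b)\<^sup>2 = b\<^sup>2 - 4 * a * c"
      by algebra
    also have "\<dots> = of_int (discr Q)"
      by (simp add: discr_def defs)
    finally have "\<exists>k. discr Q = k\<^sup>2"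
      by (intro Rats_square_eq_of_int[of "2 * c * y + b"]) (simp_all add: Rats_def)
    with assms show False by simp
  qed
qed

text \<open>If \<Delta> \<le> 0, completing the square shows that aQ(x,y) and cQ(x,y) are never
  negative. When Q takes both signs, this forces a = c = 0; then \<Delta> = b^2 gives b = 0, and Q
  vanishes.\<close>

lemma indefinite_imp_discr_pos:
  assumes "indefinite Q"
  shows "discr Q > 0"
proof (rule ccontr)
  define a b c where "a = real_of_int (coeff_xx Q)" and "b = real_of_int (coeff_xy Q)"
    and "c = real_of_int (coeff_yy Q)"
  note defs = a_def b_def c_def
  assume "\<not> discr Q > 0"
  then have "real_of_int (discr Q) \<le> 0"
    by simp
  then have disc: "b\<^sup>2 - 4 * a * c \<le> 0"
    by (simp add: discr_def defs)
  have F: "form_eval Q x y = a * x\<^sup>2 + b * x * y + c * y\<^sup>2" for x y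
    by (simp add: form_eval_def defs)
  have "(4 * a * c - b\<^sup>2) * z\<^sup>2 \<ge> 0" for z
    using disc by simp
  moreover have "4 * a * form_eval Q x y = (2 * a * x + b * y)\<^sup>2 + (4 * a * c - b\<^sup>2) * y\<^sup>2"
    "4 * c * form_eval Q x y = (2 * c * y + b * x)\<^sup>2 + (4 * a * c - b\<^sup>2) * x\<^sup>2" for x y
    unfolding F by algebra+
  ultimately have nonneg: "4 * a * form_eval Q x y \<ge> 0" "4 * c * form_eval Q x y \<ge> 0" for x y
    by simp_all
  obtain x y x' y' where *: "form_eval Q x y > 0" "form_eval Q x' y' < 0"
    using assms by (auto simp: indefinite_def)
  have "a = 0" "c = 0"
    using nonneg[of x y] nonneg[of x' y'] * by (auto simp: zero_le_mult_iff)
  with disc have "b = 0"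
    by simp
  with \<open>a = 0\<close> \<open>c = 0\<close> * F show False
    by simp
qed

lemma coeff_xx_nonzero:
  assumes "\<nexists>k. discr Q = k\<^sup>2"
  shows "coeff_xx Q \<noteq> 0"
  using assms by (auto simp: discr_def)

lemma discr_pos_imp_indefinite:
  assumes "discr Q > 0" "coeff_xx Q \<noteq> 0"
  shows "indefinite Q"
proof -
  define a b c where "a = real_of_int (coeff_xx Q)" and "b = real_of_int (coeff_xy Q)"
    and "c = real_of_int (coeff_yy Q)"
  note defs = a_def b_def c_def
  have "real_of_int (discr Q) > 0"
    using assms by simp
  then have disc: "b\<^sup>2 - 4 * a * c > 0"
    by (simp add: discr_def defs)
  have 1: "form_eval Q 1 0 = a"
    by (simp add: form_eval_def defs)
  \<comment> \<open>In 4aQ(x,y) = (2ax + by)^2 - \<Delta>y^2 the point (-b, 2a) annihilates the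
    first square, so its value has the sign opposite to that of Q(1,0) = a.\<close>
  have "form_eval Q (- b) (2 * a) = - a * (b\<^sup>2 - 4 * a * c)"
    unfolding form_eval_def defs by algebra
  with 1 disc have "form_eval Q (- b) (2 * a) < 0 \<longleftrightarrow> form_eval Q 1 0 > 0"
      "form_eval Q (- b) (2 * a) > 0 \<longleftrightarrow> form_eval Q 1 0 < 0"
    by (auto simp: mult_less_0_iff zero_less_mult_iff)
  moreover have "a \<noteq> 0"
    using assms by (simp add: a_def)
  ultimately show ?thesis
    unfolding indefinite_def using 1 by (metis linorder_neq_iff)
qed

lemma F_plus_iff: "Q \<in> F_plus \<longleftrightarrow> Q \<in> forms \<and> discr Q > 0 \<and> (\<nexists>k. discr Q = k\<^sup>2)"
  unfolding F_plus_def
  using indefinite_imp_discr_pos discr_pos_imp_indefinite coeff_xx_nonzero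
    irreducible_form_poly_imp_discr_nonsquare discr_nonsquare_imp_irreducible_form_poly
  by blast

section \<open>Pell's equation and the fundamental unit\<close>

lemma sqrt_nonsquare_irrational:
  assumes "d > 0" "\<nexists>k. d = k\<^sup>2"
  shows "sqrt (real_of_int d) \<notin> \<rat>"
  using Rats_square_eq_of_int[of "sqrt (real_of_int d)" d] assms by auto

text \<open>In h^2 - dk^2 = (h - k\<surd>d)(h + k\<surd>d) the first factor is below 1/k and the
  second at most 1 + 2k\<surd>d in absolute value. The bound is thus independent of the
  approximation h/k.\<close>

lemma approx_set_norm_bound:
  assumes "d > 0" "(h, k) \<in> approx_set (sqrt (real_of_int d))"
  shows "\<bar>h\<^sup>2 - d * k\<^sup>2\<bar> \<le> \<lceil>1 + 2 * sqrt d\<rceil>"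
proof -
  have k: "k > 0" and *: "\<bar>sqrt d - of_int h / of_int k\<bar> < 1 / (of_int k)\<^sup>2"
    using assms(2) by (auto simp: approx_set_def)
  have "\<bar>of_int h - of_int k * sqrt d\<bar> = of_int k * \<bar>sqrt d - of_int h / of_int k\<bar>"
    using k by (simp add: abs_mult_pos' right_diff_distrib abs_minus_commute)
  also have "\<dots> < of_int k * (1 / (of_int k)\<^sup>2)"
    using * k by (intro mult_strict_left_mono) auto
  also have "\<dots> = 1 / of_int k"
    using k by (simp add: power2_eq_square)
  finally have A: "\<bar>of_int h - of_int k * sqrt d\<bar> < 1 / of_int k" .
  moreover have "1 / real_of_int k \<le> 1"
    using k by simp
  moreover have "of_int k * sqrt d \<ge> 0"
    using k assms(1) by simp
  ultimately have B: "\<bar>of_int h + of_int k * sqrt d\<bar> \<le> 1 + 2 * of_int k * sqrt d"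
    by linarith
  have "\<bar>real_of_int (h\<^sup>2 - d * k\<^sup>2)\<bar>
      = \<bar>of_int h - of_int k * sqrt d\<bar> * \<bar>of_int h + of_int k * sqrt d\<bar>"
    using assms(1) by (simp add: algebra_simps power2_eq_square flip: abs_mult)
  also have "\<dots> \<le> 1 / of_int k * (1 + 2 * of_int k * sqrt d)"
    using A B k by (intro mult_mono) auto
  also have "\<dots> = 1 / of_int k + 2 * sqrt d"
    using k by (simp add: field_simps)
  also have "\<dots> \<le> 1 + 2 * sqrt d"
    using k by simp
  finally show ?thesis
    by linarith
qed

theorem pell_solution_exists:
  fixes d :: int
  assumes "d > 0" and nonsq: "\<nexists>k. d = k\<^sup>2"
  shows "\<exists>x y. y \<noteq> 0 \<and> x\<^sup>2 - d * y\<^sup>2 = 1"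
proof -
  define A where "A = approx_set (sqrt d)"
  define K where "K = \<lceil>1 + 2 * sqrt d\<rceil>"
  define nrm where "nrm = (\<lambda>(h, k). h\<^sup>2 - d * k\<^sup>2)"
  \<comment> \<open>The pigeonholes: the norm of h + k\<surd>d, together with the residues of h and
    k modulo that norm.\<close>
  define F where "F = (\<lambda>(h, k). (nrm (h, k), h mod nrm (h, k), k mod nrm (h, k)))"
  have nz: "nrm (h, k) \<noteq> 0" if "(h, k) \<in> A" for h k
  proof
    assume "nrm (h, k) = 0"
    then have "h\<^sup>2 = d * k\<^sup>2" by (simp add: nrm_def)
    moreover have "k \<noteq> 0"
      using that by (auto simp: A_def approx_set_def)
    ultimately have "(of_int h / of_int k :: real)\<^sup>2 = of_int d"
      by (simp add: field_simps flip: of_int_mult of_int_power)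
    then show False
      using nonsq Rats_square_eq_of_int[of "of_int h / of_int k :: real" d] by auto
  qed
  have mod_bound: "x mod n \<in> {-K..K}" if "n \<noteq> 0" "\<bar>n\<bar> \<le> K" for x n :: int
    using abs_mod_less[OF that(1), of x] that(2) by auto
  have "F ` A \<subseteq> {-K..K} \<times> {-K..K} \<times> {-K..K}"
  proof (intro image_subsetI)
    fix a assume "a \<in> A"
    then obtain h k where hk: "(h, k) \<in> A" and a: "a = (h, k)"
      by (metis surj_pair)
    from hk have "\<bar>nrm (h, k)\<bar> \<le> K"
      using approx_set_norm_bound[OF assms(1)] by (simp add: A_def K_def nrm_def)
    with nz[OF hk] mod_bound show "F a \<in> {-K..K} \<times> {-K..K} \<times> {-K..K}"
      by (auto simp: F_def a)
  qed
  then have "finite (F ` A)"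
    by (rule finite_subset) auto
  moreover have "infinite A"
    unfolding A_def using sqrt_nonsquare_irrational[OF assms] rational_iff_finite_approx_set by blast
  ultimately obtain a where a: "a \<in> A" "infinite {a' \<in> A. F a' = F a}"
    using pigeonhole_infinite by blast
  then have "{a' \<in> A. F a' = F a} - {a} \<noteq> {}"
    using infinite_remove finite.emptyI by metis
  then obtain a' where a': "a' \<in> A" "F a' = F a" "a' \<noteq> a"
    by blast
  obtain h k h' k' where hk: "a = (h, k)" "a' = (h', k')"
    by (metis surj_pair)
  have pos: "k > 0" "k' > 0"
    using a(1) a'(1) by (auto simp: hk A_def approx_set_def)
  define N where "N = h\<^sup>2 - d * k\<^sup>2"
  have N: "N \<noteq> 0" "h'\<^sup>2 - d * k'\<^sup>2 = N" "h' mod N = h mod N" "k' mod N = k mod N"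
    using nz[of h k] a(1) a'(2) by (auto simp: hk F_def nrm_def N_def)
  obtain \<alpha> where \<alpha>: "h' = h + N * \<alpha>"
    using N(3) by (metis mod_eqE)
  obtain \<beta> where \<beta>: "k' = k + N * \<beta>"
    using N(4) by (metis mod_eqE)
  \<comment> \<open>x + y\<surd>d is the quotient (h' + k'\<surd>d)/(h + k\<surd>d). The congruences
    modulo N make it integral, and it has norm 1 since numerator and denominator have the same
    norm.\<close>
  define x y where "x = 1 + (h * \<alpha> - d * k * \<beta>)" and "y = h * \<beta> - k * \<alpha>"
  have Nx: "N * x = h * h' - d * k * k'" and Ny: "N * y = h * k' - k * h'"
    unfolding x_def y_def \<alpha> \<beta> N_def by algebra+
  have "N\<^sup>2 * (x\<^sup>2 - d * y\<^sup>2) = (N * x)\<^sup>2 - d * (N * y)\<^sup>2"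
    by algebra
  also have "\<dots> = (h\<^sup>2 - d * k\<^sup>2) * (h'\<^sup>2 - d * k'\<^sup>2)"
    unfolding Nx Ny by algebra
  also have "\<dots> = N\<^sup>2 * 1"
    unfolding N(2) N_def[symmetric] by (simp add: power2_eq_square)
  finally have "x\<^sup>2 - d * y\<^sup>2 = 1"
    using N(1) by (subst (asm) mult_left_cancel) auto
  moreover have "y \<noteq> 0"
  proof
    \<comment> \<open>The quotient would be rational: h/k = h'/k'. With equal nonzero norms this
      yields k = k' and h = h', although the two approximations are distinct.\<close>
    assume "y = 0"
    with Ny have eq: "h * k' = k * h'"
      by simp
    have "N * k'\<^sup>2 = (h * k')\<^sup>2 - d * k\<^sup>2 * k'\<^sup>2"
      unfolding N_def by algebra
    also have "\<dots> = (h'\<^sup>2 - d * k'\<^sup>2) * k\<^sup>2"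
      unfolding eq by algebra
    finally have "k'\<^sup>2 = k\<^sup>2"
      using N by simp
    then have "k' = k"
      using pos by (simp add: power2_eq_iff)
    with eq pos a'(3) hk show False
      by simp
  qed
  ultimately show ?thesis by blast
qed

text \<open>The conjugate z' satisfies |zz'| = 1, so z > 1 gives |z'| \<le> 1. The bounds follow
  from t = z + z', u\<surd>d = z - z' and \<surd>d \<ge> 1.\<close>

lemma unit_bounds:
  fixes t u d :: int
  assumes "d > 0" "t\<^sup>2 - d * u\<^sup>2 \<in> {4, -4}" "(of_int t + of_int u * sqrt d) / 2 > 1"
    "(of_int t + of_int u * sqrt d) / 2 \<le> C"
  shows "\<bar>real_of_int t\<bar> \<le> C + 1" "\<bar>real_of_int u\<bar> \<le> C + 1"
proof -
  define z z' where "z = (of_int t + of_int u * sqrt d) / 2" and "z' = (of_int t - of_int u * sqrt d) / 2"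
  have "4 * (z * z') = (of_int t)\<^sup>2 - (sqrt d)\<^sup>2 * (of_int u)\<^sup>2"
    unfolding z_def z'_def by (simp add: field_simps power2_eq_square)
  also have "\<dots> = of_int (t\<^sup>2 - d * u\<^sup>2)"
    using assms(1) by simp
  finally have "4 * (z * z') = of_int (t\<^sup>2 - d * u\<^sup>2)" .
  moreover have "real_of_int n \<in> {4, -4}" if "n \<in> {4, -4}" for n
    using that by auto
  ultimately have "4 * (z * z') \<in> {4, -4}"
    using assms(2) by metis
  then have "4 * (z * z') = 4 \<or> 4 * (z * z') = -4"
    by blast
  then have "\<bar>z * z'\<bar> = 1"
    by linarith
  then have "z * \<bar>z'\<bar> = 1"
    using assms(3) by (simp add: abs_mult flip: z_def)
  moreover have "z > 1" "z \<le> C"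
    using assms(3,4) by (auto simp: z_def)
  ultimately have z': "\<bar>z'\<bar> \<le> 1"
    by (smt (verit) mult_less_cancel_right2)
  have "of_int t = z + z'" "of_int u * sqrt d = z - z'"
    by (simp_all add: z_def z'_def field_simps)
  then have "\<bar>real_of_int t\<bar> \<le> C + 1" "\<bar>of_int u * sqrt d\<bar> \<le> C + 1"
    using z' \<open>z > 1\<close> \<open>z \<le> C\<close> by linarith+
  moreover have "\<bar>real_of_int u\<bar> * 1 \<le> \<bar>real_of_int u\<bar> * sqrt d"
    using assms(1) by (intro mult_left_mono) auto
  ultimately show "\<bar>real_of_int t\<bar> \<le> C + 1" "\<bar>real_of_int u\<bar> \<le> C + 1"
    using assms(1) by (auto simp: abs_mult)
qed

lemma fundamental_unit_exists:
  fixes d :: int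
  assumes "d > 0" and "\<nexists>k. d = k\<^sup>2"
  obtains t u :: int where "t\<^sup>2 - d * u\<^sup>2 \<in> {4, -4}" "(of_int t + of_int u * sqrt d) / 2 > 1"
    "\<And>t' u'. t'\<^sup>2 - d * u'\<^sup>2 \<in> {4, -4} \<Longrightarrow> (of_int t' + of_int u' * sqrt d) / 2 > 1 \<Longrightarrow>
        (of_int t + of_int u * sqrt d) / 2 \<le> (of_int t' + of_int u' * sqrt d) / 2"
proof -
  define val where "val = (\<lambda>(t, u). (of_int t + of_int u * sqrt d) / 2)"
  define U where "U = {(t, u). t\<^sup>2 - d * u\<^sup>2 \<in> {4, -4} \<and> val (t, u) > 1}"
  obtain x y where xy: "y \<noteq> 0" "x\<^sup>2 - d * y\<^sup>2 = 1"
    using pell_solution_exists[OF assms] by blast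
  \<comment> \<open>Doubling turns norm 1 into t^2 - du^2 = 4, and absolute values make the unit |x|
    + |y|\<surd>d larger than 1.\<close>
  define p where "p = (2 * \<bar>x\<bar>, 2 * \<bar>y\<bar>)"
  have "x \<noteq> 0"
    using xy assms(1) by (auto simp: power2_eq_square) (smt (verit) mult_nonneg_nonneg zero_le_square)
  then have "real_of_int \<bar>x\<bar> \<ge> 1" "real_of_int \<bar>y\<bar> * sqrt d > 0"
    using xy(1) assms(1) by auto
  then have "val p > 1"
    by (simp add: val_def p_def)
  moreover have "(2 * \<bar>x\<bar>)\<^sup>2 - d * (2 * \<bar>y\<bar>)\<^sup>2 = 4"
    using xy(2) by (simp add: power_mult_distrib)
  ultimately have p: "p \<in> U"
    by (simp add: U_def p_def)
  \<comment> \<open>Only finitely many units in \<open>U\<close> have value at most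
    \<open>val p\<close>, by \<open>unit_bounds\<close>. The least of them is the least in all of
    \<open>U\<close>.\<close>
  define V where "V = {q \<in> U. val q \<le> val p}"
  define K where "K = \<lceil>val p + 1\<rceil>"
  have "V \<subseteq> {-K..K} \<times> {-K..K}"
  proof clarify
    fix t u assume tu: "(t, u) \<in> V"
    then have "\<bar>real_of_int t\<bar> \<le> val p + 1" "\<bar>real_of_int u\<bar> \<le> val p + 1"
      using unit_bounds[OF assms(1), of t u "val p"] by (auto simp: V_def U_def val_def)
    then have "\<bar>t\<bar> \<le> K" "\<bar>u\<bar> \<le> K"
      unfolding K_def by linarith+
    then show "t \<in> {-K..K} \<and> u \<in> {-K..K}"
      by auto
  qed
  then have "finite V"
    by (rule finite_subset) auto
  moreover have "p \<in> V"
    using p by (simp add: V_def)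
  ultimately obtain m where m: "m \<in> V" "\<And>q. q \<in> V \<Longrightarrow> val m \<le> val q"
    by (metis arg_min_if_finite(1) arg_min_least empty_iff)
  have le: "val m \<le> val q" if "q \<in> U" for q
  proof (cases "val q \<le> val p")
    case True
    with that m(2) show ?thesis by (simp add: V_def)
  next
    case False
    with m(1) show ?thesis by (simp add: V_def)
  qed
  obtain t u where tu: "m = (t, u)"
    by (metis surj_pair)
  show thesis
    by (rule that[of t u]) (use m(1) le tu in \<open>auto simp: V_def U_def val_def\<close>)
qed

section \<open>Units of the quadratic order\<close>

lemma discr_mod_4: "discr Q mod 4 = 0 \<or> discr Q mod 4 = 1"
proof -
  have "discr Q mod 4 = (coeff_xy Q)\<^sup>2 mod 4"
    by (simp add: discr_def mod_diff_eq[symmetric] mult.assoc)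
  also have "\<dots> = 0 \<or> \<dots> = 1"
  proof (cases "even (coeff_xy Q)")
    case True
    then obtain k where "coeff_xy Q = 2 * k" ..
    then show ?thesis by (simp add: power2_eq_square)
  next
    case False
    then obtain k where "coeff_xy Q = 2 * k + 1" by (elim oddE)
    then have "(coeff_xy Q)\<^sup>2 = 1 + 4 * (k\<^sup>2 + k)"
      by (simp add: power2_eq_square algebra_simps)
    then have "(coeff_xy Q)\<^sup>2 mod 4 = 1"
      by (simp only: mod_mult_self2) simp
    then show ?thesis ..
  qed
  finally show ?thesis .
qed

text \<open>Write \<Delta> = Dg^2 with D square-free. If D is not 1 modulo 4, then g must be even:
  an odd g gives \<Delta> congruent to D modulo 4, and since \<Delta> is 0 or 1 modulo 4, 4 would
  divide D. So the conductor is |g| or |g|/2.\<close>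

lemma conductor_int:
  assumes "discr Q > 0"
  obtains f :: int where "f > 0" "conductor Q = of_int f" "discr Q = f\<^sup>2 * fund_discr Q"
proof -
  define D g where "D = squarefree_part (discr Q)" and "g = square_part (discr Q)"
  have Dg: "discr Q = D * g\<^sup>2"
    unfolding D_def g_def by (rule squarefree_decompose)
  with assms have "g \<noteq> 0" "D > 0"
    by (auto simp: zero_less_mult_iff)
  have "\<exists>f. f > 0 \<and> discr Q = f\<^sup>2 * fund_discr Q"
  proof (cases "D mod 4 = 1")
    case True
    then have "fund_discr Q = D"
      by (simp add: fund_discr_def D_def)
    then show ?thesis
      using Dg \<open>g \<noteq> 0\<close> by (intro exI[of _ "\<bar>g\<bar>"]) simp
  next
    case False
    then have F: "fund_discr Q = 4 * D"
      by (simp add: fund_discr_def D_def Let_def)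
    have "even g"
    proof (rule ccontr)
      assume "odd g"
      then obtain k where "g = 2 * k + 1" by (elim oddE)
      then have "discr Q = D + 4 * (D * (k\<^sup>2 + k))"
        by (simp add: Dg power2_eq_square algebra_simps)
      then have "discr Q mod 4 = D mod 4"
        by simp
      with False discr_mod_4[of Q] have "4 dvd D"
        by auto
      then have "2\<^sup>2 dvd D"
        by simp
      moreover have "squarefree D"
        by (simp add: D_def)
      ultimately have "is_unit (2 :: int)"
        using squarefreeD by blast
      then show False
        by simp
    qed
    then obtain h where "g = 2 * h" ..
    then show ?thesis
      using Dg F \<open>g \<noteq> 0\<close> by (intro exI[of _ "\<bar>h\<bar>"]) (simp add: power_mult_distrib)
  qed
  then obtain f where f: "f > 0" "discr Q = f\<^sup>2 * fund_discr Q"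
    by blast
  then have "fund_discr Q \<noteq> 0"
    using assms by auto
  then have "conductor Q = of_int f"
    using f by (simp add: conductor_def)
  with f that show thesis by blast
qed

text \<open>Rewriting the order in terms of \<surd>\<Delta> turns it into the numbers (t +
  u\<surd>\<Delta>)/2 with t congruent to u\<Delta> modulo 2. Its units are its elements of norm
  \<plusminus>1.\<close>

lemma order_units_eq:
  assumes "discr Q > 0" "\<nexists>k. discr Q = k\<^sup>2"
  shows "order_units Q =
    {(of_int t + of_int u * sqrt (discr Q)) / 2 | t u. t\<^sup>2 - discr Q * u\<^sup>2 \<in> {4, -4}}"
proof -
  define d where "d = discr Q"
  define s where "s = sqrt d"
  obtain f where f: "f > 0" "conductor Q = of_int f" "d = f\<^sup>2 * fund_discr Q"
    using conductor_int[OF assms(1)] unfolding d_def by blast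
  have s2: "s * s = of_int d"
    using assms(1) by (simp add: s_def d_def)
  have irr: "s \<notin> \<rat>"
    using sqrt_nonsquare_irrational[OF assms] by (simp add: s_def d_def)
  have fs: "of_int f * sqrt (fund_discr Q) = s"
    using f by (simp add: s_def real_sqrt_mult)
  have "even (f * fund_discr Q) \<longleftrightarrow> even d"
    by (simp add: f(3))
  then have par: "even (u * f * fund_discr Q - u * d)" for u
    by auto
  have ord: "z \<in> quad_order Q \<longleftrightarrow>
      (\<exists>t u. z = (of_int t + of_int u * s) / 2 \<and> even (t - u * d))" (is "_ \<longleftrightarrow> ?R z") for z
  proof
    assume "z \<in> quad_order Q"
    then obtain m n where z: "z = of_int m + of_int n * conductor Q *
        ((of_int (fund_discr Q) + sqrt (of_int (fund_discr Q))) / 2)"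
      by (auto simp: quad_order_def)
    have "z = (of_int (2 * m + n * f * fund_discr Q) + of_int n * s) / 2"
      by (simp add: z f(2) fs[symmetric] field_simps)
    moreover have "even (2 * m + n * f * fund_discr Q - n * d)"
      using par[of n] by (simp add: algebra_simps)
    ultimately show "?R z" by blast
  next
    assume "?R z"
    then obtain t u where z: "z = (of_int t + of_int u * s) / 2" and "even (t - u * d)"
      by blast
    then have "even (t - u * f * fund_discr Q)"
      using par[of u] by presburger
    then obtain m where "t - u * f * fund_discr Q = 2 * m" ..
    then have "t = 2 * m + u * f * fund_discr Q"
      by simp
    then have "z = of_int m + of_int u * conductor Q *
        ((of_int (fund_discr Q) + sqrt (of_int (fund_discr Q))) / 2)"
      by (simp add: z f(2) fs[symmetric] field_simps)
    then show "z \<in> quad_order Q"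
      by (auto simp: quad_order_def)
  qed
  \<comment> \<open>The norm of an element of the order is an integer: after substituting t = ud +
    2k, it suffices that d(d - 1) is divisible by 4, which holds as d is 0 or 1 modulo 4.\<close>
  have norm4: "4 dvd t\<^sup>2 - d * u\<^sup>2" if tu: "even (t - u * d)" for t u
  proof -
    obtain k where "t - u * d = 2 * k"
      using tu ..
    then have t: "t = u * d + 2 * k"
      by simp
    have "t\<^sup>2 - d * u\<^sup>2 = u\<^sup>2 * (d * (d - 1)) + 4 * (k * u * d + k\<^sup>2)"
      unfolding t by algebra
    moreover have "4 dvd d \<or> 4 dvd d - 1"
      using discr_mod_4[of Q] unfolding d_def by presburger
    then have "4 dvd d * (d - 1)"
      by auto
    ultimately show ?thesis
      by simp
  qed
  show ?thesis
  proof (intro equalityI subsetI)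
    fix z assume "z \<in> order_units Q"
    then obtain w where "z \<in> quad_order Q" "w \<in> quad_order Q" and zw: "z * w = 1"
      by (auto simp: order_units_def)
    then obtain t u t' u' where z: "z = (of_int t + of_int u * s) / 2" "even (t - u * d)"
        and w: "w = (of_int t' + of_int u' * s) / 2" "even (t' - u' * d)"
      using ord by blast
    have "4 * (z * w) = of_int t * of_int t' + of_int u * of_int u' * (s * s)
        + (of_int t * of_int u' + of_int t' * of_int u) * s"
      by (simp add: z w algebra_simps)
    \<comment> \<open>The equation zw = 1 is split into its irrational and rational parts,
      \<open>1\<close> and \<open>2\<close> below. Together they show that the integral norms n and
      n' have product 1.\<close>
    then have *: "of_int (t * u' + t' * u) * s = of_int (4 - (t * t' + d * u * u'))"
      unfolding s2 zw by (simp add: algebra_simps)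
    have 1: "t * u' + t' * u = 0"
    proof (rule ccontr)
      assume "t * u' + t' * u \<noteq> 0"
      then have "s = of_int (4 - (t * t' + d * u * u')) / of_int (t * u' + t' * u)"
        using * by (simp add: field_simps del: of_int_add of_int_mult of_int_diff)
      also have "\<dots> \<in> \<rat>"
        by (intro Rats_divide Rats_of_int)
      finally show False
        using irr by simp
    qed
    with * have "real_of_int (4 - (t * t' + d * u * u')) = 0"
      by simp
    then have 2: "t * t' + d * u * u' = 4"
      by linarith
    obtain n n' where n: "t\<^sup>2 - d * u\<^sup>2 = 4 * n" "t'\<^sup>2 - d * u'\<^sup>2 = 4 * n'"
      using norm4[OF z(2)] norm4[OF w(2)] by (meson dvdE)
    have "(t\<^sup>2 - d * u\<^sup>2) * (t'\<^sup>2 - d * u'\<^sup>2)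
        = (t * t' + d * u * u')\<^sup>2 - d * (t * u' + t' * u)\<^sup>2"
      by algebra
    then have "n * n' = 1"
      by (simp add: 1 2 n)
    then have "n = 1 \<or> n = -1"
      using zmult_eq_1_iff by blast
    with n z(1) show "z \<in> {(of_int t + of_int u * sqrt (discr Q)) / 2 | t u. t\<^sup>2 - discr Q * u\<^sup>2 \<in> {4, -4}}"
      unfolding s_def d_def by force
  next
    fix z assume "z \<in> {(of_int t + of_int u * sqrt (discr Q)) / 2 | t u. t\<^sup>2 - discr Q * u\<^sup>2 \<in> {4, -4}}"
    then obtain t u where z: "z = (of_int t + of_int u * s) / 2" and tu: "t\<^sup>2 - d * u\<^sup>2 \<in> {4, -4}"
      unfolding s_def d_def by blast
    have "even n" if "n \<in> {4, -4}" for n :: int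
      using that by auto
    from this[OF tu] have ev: "even (t - u * d)" by auto
    have "\<exists>e. (e = 1 \<or> e = -1) \<and> t\<^sup>2 - d * u\<^sup>2 = 4 * e"
      using tu by auto
    then obtain e where e: "e = 1 \<or> e = -1" "t\<^sup>2 - d * u\<^sup>2 = 4 * e"
      by blast
    \<comment> \<open>The inverse of a unit of norm e = \<plusminus>1 is e times its
      conjugate.\<close>
    define w where "w = (of_int (e * t) + of_int (- e * u) * s) / 2"
    have "even (e * t - (- e * u) * d)"
      using ev e(1) by auto
    then have "w \<in> quad_order Q"
      unfolding ord w_def by blast
    moreover have "z \<in> quad_order Q"
      unfolding ord using z ev by blast
    moreover have zw: "2 * z = of_int t + of_int u * s" "2 * w = of_int e * (of_int t - of_int u * s)"
      by (simp_all add: z w_def field_simps)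
    have "(2 * z) * (2 * w) = of_int (e * (t\<^sup>2 - d * u\<^sup>2))"
      unfolding zw by (simp add: algebra_simps power2_eq_square s2[symmetric])
    then have "4 * (z * w) = of_int (e * (t\<^sup>2 - d * u\<^sup>2))"
      by simp
    then have "z * w = 1"
      unfolding e(2) using e(1) by auto
    ultimately show "z \<in> order_units Q"
      by (auto simp: order_units_def)
  qed
qed

text \<open>Since \<surd>\<Delta> is the conductor f times the square root of
  \<open>fund_discr Q\<close>, the argument of \<open>chi\<close> has y = uf/2. The coefficient 2y/f
  of SQ is then u.\<close>

lemma chi_unit:
  assumes "discr Q > 0" "\<nexists>k. discr Q = k\<^sup>2"
  shows "chi Q ((of_int t + of_int u * sqrt (discr Q)) / 2) = stab_elt Q t u"
proof -
  obtain f where f: "f > 0" "conductor Q = of_int f" "discr Q = f\<^sup>2 * fund_discr Q"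
    using conductor_int[OF assms(1)] by blast
  have "fund_discr Q > 0"
    using f assms(1) by (simp add: zero_less_mult_iff)
  moreover have "\<nexists>k. fund_discr Q = k\<^sup>2"
    using assms(2) f(3) by (metis power_mult_distrib)
  ultimately have irr: "sqrt (fund_discr Q) \<notin> \<rat>"
    by (rule sqrt_nonsquare_irrational)
  have "of_int f * sqrt (fund_discr Q) = sqrt (discr Q)"
    using f by (simp add: real_sqrt_mult)
  then have "(of_int t + of_int u * sqrt (discr Q)) / 2
      = of_int t / 2 + (of_int u * of_int f / 2) * sqrt (fund_discr Q)"
    by (simp add: field_simps)
  then have "chi Q ((of_int t + of_int u * sqrt (discr Q)) / 2)
    = (of_int t / 2) *\<^sub>R mat 1 + (2 * (of_int u * of_int f / 2) / conductor Q) *\<^sub>R (S_mat ** form_mat Q)"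
    by (simp only:) (intro chi_eq[OF irr]; simp)
  then show ?thesis
    using f by (simp add: stab_elt_def)
qed

lemma stab_eq_chi_order_units:
  assumes "Q \<in> F_plus"
  shows "stab Q = chi Q ` order_units Q"
proof -
  have Q: "Q \<in> forms" "discr Q > 0" "\<nexists>k. discr Q = k\<^sup>2"
    using assms by (auto simp: F_plus_iff)
  show ?thesis
    unfolding stab_eq[OF Q(1)] order_units_eq[OF Q(2,3)]
    unfolding chi_unit[OF Q(2,3), symmetric] by blast
qed

section \<open>The structure of the stability group\<close>

lemma stab_eq_generate_GL2Z:
  assumes "Q \<in> forms" "K \<subseteq> stab Q" "stab Q = generate (stab_group Q) K"
  shows "stab Q = generate GL2Z K"
proof -
  have "generate (stab_group Q) K = generate GL2Z K"
    unfolding stab_group_def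
    by (rule group.generate_consistent[OF group_GL2Z assms(2) subgroup_stab[OF assms(1)]])
  then show ?thesis
    by (rule trans[OF assms(3)])
qed

lemma S_form_eq_stab_elt:
  "(1/2) *\<^sub>R mat 1 + S_mat ** form_mat Q = stab_elt Q 1 1"
  "mat 1 + S_mat ** form_mat Q = stab_elt Q 2 1"
  "2 *\<^sub>R (S_mat ** form_mat Q) = stab_elt Q 0 2"
  "S_mat ** form_mat Q = stab_elt Q 0 1"
  by (simp_all add: stab_elt_def)

lemma stab_cyclic:
  assumes Q: "Q \<in> forms" and x: "x \<in> stab Q" "x [^]\<^bsub>stab_group Q\<^esub> k = mat 1"
    and gen: "stab Q \<subseteq> range (\<lambda>i::int. x [^]\<^bsub>stab_group Q\<^esub> i)"
    and triv: "\<And>i. i \<in> carrier (integer_mod_group k) \<Longrightarrow> x [^]\<^bsub>stab_group Q\<^esub> i = mat 1 \<Longrightarrow> i = 0"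
  shows "stab Q = generate GL2Z {x} \<and> stab_group Q \<cong> integer_mod_group k"
proof
  interpret G: comm_group "stab_group Q"
    using comm_group_stab_group[OF Q] .
  show "stab_group Q \<cong> integer_mod_group k"
    using assms by (intro G.iso_integer_mod_group) auto
  have "generate (stab_group Q) {x} = range (\<lambda>i::int. x [^]\<^bsub>stab_group Q\<^esub> i)"
    using G.generate_pow[of x] x by auto
  moreover have "generate (stab_group Q) {x} \<subseteq> stab Q"
    using G.generate_incl[of "{x}"] x by simp
  ultimately show "stab Q = generate GL2Z {x}"
    using gen x by (intro stab_eq_generate_GL2Z[OF Q]) auto
qed

section \<open>The stability group as a multiplicative group of real numbers\<close>

lemma (in group) power_int_of_mult_hom:
  fixes \<psi> :: "'a \<Rightarrow> real"
  assumes mult: "\<And>x y. x \<in> carrier G \<Longrightarrow> y \<in> carrier G \<Longrightarrow> \<psi> (x \<otimes> y) = \<psi> x * \<psi> y"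
    and one: "\<psi> \<one> = 1" and x: "x \<in> carrier G"
  shows "\<psi> (x [^] (n :: int)) = \<psi> x powi n"
proof -
  have nat: "\<psi> (x [^] k) = \<psi> x ^ k" for k :: nat
    by (induction k) (simp_all add: one mult x)
  have inv: "\<psi> (inv y) = inverse (\<psi> y)" if y: "y \<in> carrier G" for y
  proof -
    have "\<psi> (inv y) * \<psi> y = 1"
      using mult[of "inv y" y] y one by simp
    then show ?thesis
      using inverse_unique by (metis mult.commute)
  qed
  show ?thesis
    unfolding int_pow_def2 power_int_def
    by (simp add: nat inv x power_inverse not_less del: pow_nat)
qed

text \<open>Reads off \<open>(t + u\<surd>\<Delta>)/2\<close> from the matrix \<open>(t/2) I + u SQ\<close>; this needs \<open>a \<noteq> 0\<close>, which holds for nonsquare \<open>\<Delta>\<close>.\<close>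
definition stab_unit :: "bqf \<Rightarrow> real^2^2 \<Rightarrow> real" where
  "stab_unit Q M = (M$1$1 + M$2$2 + M$2$1 / of_int (coeff_xx Q) * sqrt (discr Q)) / 2"

lemma stab_unit_stab_elt:
  assumes "coeff_xx Q \<noteq> 0"
  shows "stab_unit Q (stab_elt Q t u) = (of_int t + of_int u * sqrt (discr Q)) / 2"
  using assms by (simp add: stab_unit_def stab_elt_nth field_simps)

lemma stab_unit_mult:
  assumes "Q \<in> F_plus" "A \<in> stab Q" "B \<in> stab Q"
  shows "stab_unit Q (A ** B) = stab_unit Q A * stab_unit Q B"
proof -
  have Q: "Q \<in> forms" "discr Q > 0" "coeff_xx Q \<noteq> 0"
    using assms(1) coeff_xx_nonzero by (auto simp: F_plus_iff)
  obtain t u t' u' where A: "A = stab_elt Q t u" "t\<^sup>2 - discr Q * u\<^sup>2 \<in> {4, -4}"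
      and B: "B = stab_elt Q t' u'" "t'\<^sup>2 - discr Q * u'\<^sup>2 \<in> {4, -4}"
    using assms stabE[OF Q(1)] by metis
  obtain t'' u'' where tu: "2 * t'' = t * t' + discr Q * u * u'" "2 * u'' = t * u' + t' * u"
    using pell_mult_closed A B by metis
  have s: "sqrt (discr Q) * sqrt (discr Q) = of_int (discr Q)"
    using Q(2) by simp
  have t: "2 * real_of_int t'' = of_int t * of_int t' + sqrt (discr Q) * sqrt (discr Q) * of_int u * of_int u'"
    using arg_cong[OF tu(1), of real_of_int] unfolding s by simp
  have u: "2 * real_of_int u'' = of_int t * of_int u' + of_int t' * of_int u"
    using arg_cong[OF tu(2), of real_of_int] by simp
  have "2 * (of_int t'' + of_int u'' * sqrt (discr Q))
      = (of_int t + of_int u * sqrt (discr Q)) * (of_int t' + of_int u' * sqrt (discr Q))"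
    unfolding distrib_left t mult.assoc[symmetric] u by (simp add: algebra_simps)
  then show ?thesis
    using stab_elt_mult[OF tu] by (simp add: A B stab_unit_stab_elt[OF Q(3)])
qed

text \<open>The kernel is trivial because \<surd>\<Delta> is irrational: t + u\<surd>\<Delta> = 2
  forces u = 0 and t = 2.\<close>

lemma stab_unit_eq_1_iff:
  assumes "Q \<in> F_plus" "M \<in> stab Q"
  shows "stab_unit Q M = 1 \<longleftrightarrow> M = mat 1"
proof
  have Q: "Q \<in> forms" "discr Q > 0" "\<nexists>k. discr Q = k\<^sup>2" "coeff_xx Q \<noteq> 0"
    using assms(1) coeff_xx_nonzero by (auto simp: F_plus_iff)
  show "stab_unit Q M = 1" if "M = mat 1"
    using that stab_unit_stab_elt[OF Q(4), of 2 0] by (simp add: mat1_eq_stab_elt[of Q])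
  assume 1: "stab_unit Q M = 1"
  obtain t u where M: "M = stab_elt Q t u"
    using stabE[OF Q(1) assms(2)] .
  have eq: "of_int t + of_int u * sqrt (discr Q) = 2"
    using 1 by (simp add: M stab_unit_stab_elt[OF Q(4)])
  have "u = 0"
  proof (rule ccontr)
    assume "u \<noteq> 0"
    then have "sqrt (discr Q) = (2 - of_int t) / of_int u"
      using eq by (simp add: field_simps)
    also have "\<dots> \<in> \<rat>"
      by simp
    finally show False
      using sqrt_nonsquare_irrational[OF Q(2,3)] by simp
  qed
  with eq show "M = mat 1"
    by (simp add: M mat1_eq_stab_elt[of Q])
qed

section \<open>Generation by -I and one further element; the infinite case of
  \<open>F_plus\<close>\<close>

lemma minus_mat1_square: "(- mat 1 :: real^2^2) ** - mat 1 = mat 1"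
  unfolding mat2_eq_iff by (simp add: matrix_matrix_mult_def sum_2 mat_def)

lemma mat1_in_stab:
  assumes "Q \<in> forms"
  shows "mat 1 \<in> stab Q" "- mat 1 \<in> stab Q"
  using stab_elt_in_stab_iff[OF assms, of 2 0] stab_elt_in_stab_iff[OF assms, of "-2" 0]
  by (simp_all flip: mat1_eq_stab_elt minus_mat1_eq_stab_elt)

text \<open>This is the division with remainder that reduces a positive unit by a power of the
  fundamental one; the exponent is the integer part of log z to the base b.\<close>

lemma power_int_bounds:
  fixes b z :: real
  assumes "b > 1" "z > 0"
  obtains n :: int where "b powi n \<le> z" "z < b powi n * b"
proof
  let ?n = "\<lfloor>log b z\<rfloor>"
  have eq: "b powr log b z = z"
    using assms by simp
  have powi: "b powr of_int k = b powi k" for k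
    using assms by (simp add: powr_real_of_int')
  have "b powr of_int ?n \<le> b powr log b z"
    using assms by (intro powr_mono) auto
  then show "b powi ?n \<le> z"
    by (simp only: eq powi)
  have "b powr log b z < b powr of_int (?n + 1)"
    using assms by (intro powr_less_mono) linarith+
  then show "z < b powi ?n * b"
    using assms by (simp only: eq powi) (simp add: power_int_add)
qed

text \<open>The condition \<open>neg\<close> keeps -I from being a power of y, which makes the
  product with the group {I, -I} direct. The lemma serves \<open>F_plus\<close> and discriminant 0
  with \<open>l = 0\<close>, and discriminants 1 and 4 with \<open>l = 2\<close>.\<close>

lemma stab_two_generators:
  assumes Q: "Q \<in> forms" and y: "y \<in> stab Q" "y [^]\<^bsub>stab_group Q\<^esub> l = mat 1"
    and gen: "\<And>M. M \<in> stab Q \<Longrightarrow> \<exists>j::int. M = y [^]\<^bsub>stab_group Q\<^esub> j \<or> M = - mat 1 ** y [^]\<^bsub>stab_group Q\<^esub> j"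
    and triv: "\<And>j. j \<in> carrier (integer_mod_group l) \<Longrightarrow> y [^]\<^bsub>stab_group Q\<^esub> j = mat 1 \<Longrightarrow> j = 0"
    and neg: "\<And>j. j \<in> carrier (integer_mod_group l) \<Longrightarrow> - mat 1 ** y [^]\<^bsub>stab_group Q\<^esub> j \<noteq> mat 1"
  shows "stab Q = generate GL2Z {- mat 1, y} \<and>
    stab_group Q \<cong> integer_mod_group 2 \<times>\<times> integer_mod_group l"
proof
  interpret G: comm_group "stab_group Q"
    using comm_group_stab_group[OF Q] .
  let ?h = "- mat 1 :: real^2^2"
  have h: "?h \<in> stab Q"
    using mat1_in_stab[OF Q] by simp
  have pow: "?h [^]\<^bsub>stab_group Q\<^esub> (0::int) \<otimes>\<^bsub>stab_group Q\<^esub> y [^]\<^bsub>stab_group Q\<^esub> j = y [^]\<^bsub>stab_group Q\<^esub> j"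
    "?h [^]\<^bsub>stab_group Q\<^esub> (1::int) \<otimes>\<^bsub>stab_group Q\<^esub> y [^]\<^bsub>stab_group Q\<^esub> j = ?h ** y [^]\<^bsub>stab_group Q\<^esub> j" for j :: int
    using h by simp_all
  have gen': "\<exists>(i::int) (j::int). M = ?h [^]\<^bsub>stab_group Q\<^esub> i \<otimes>\<^bsub>stab_group Q\<^esub> y [^]\<^bsub>stab_group Q\<^esub> j"
    if "M \<in> carrier (stab_group Q)" for M
    using gen[of M] that pow by (metis stab_group_simps(1))
  show "stab_group Q \<cong> integer_mod_group 2 \<times>\<times> integer_mod_group l"
  proof (rule G.iso_integer_mod_group_Times[OF _ _ _ _ gen'])
    show "?h \<in> carrier (stab_group Q)" "y \<in> carrier (stab_group Q)"
      "y [^]\<^bsub>stab_group Q\<^esub> l = \<one>\<^bsub>stab_group Q\<^esub>"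
      using h y by simp_all
    show "?h [^]\<^bsub>stab_group Q\<^esub> (2::nat) = \<one>\<^bsub>stab_group Q\<^esub>"
      using h by (simp add: numeral_2_eq_2 minus_mat1_square)
    fix i j
    assume i: "i \<in> carrier (integer_mod_group 2)" and j: "j \<in> carrier (integer_mod_group l)"
      and 1: "?h [^]\<^bsub>stab_group Q\<^esub> i \<otimes>\<^bsub>stab_group Q\<^esub> y [^]\<^bsub>stab_group Q\<^esub> j = \<one>\<^bsub>stab_group Q\<^esub>"
    have "i = 0 \<or> i = 1"
      using i by (auto simp: carrier_integer_mod_group)
    then show "i = 0 \<and> j = 0"
      using 1 pow triv[OF j] neg[OF j] by (metis stab_group_simps(3))
  qed
  have "stab Q = generate (stab_group Q) {?h, y}"
    using G.carrier_eq_generate_pair[OF _ _ gen'] h y by simp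
  then show "stab Q = generate GL2Z {?h, y}"
    using h y by (intro stab_eq_generate_GL2Z[OF Q]) auto
qed

lemma minus_mat1_mult_stab_elt: "- mat 1 ** stab_elt Q t u = stab_elt Q (-t) (-u)"
  unfolding minus_mat1_eq_stab_elt[of Q] by (rule stab_elt_mult) simp_all

theorem stab_group_iso_F_plus:
  assumes "Q \<in> F_plus"
  shows "stab_group Q \<cong> integer_mod_group 2 \<times>\<times> integer_group"
proof -
  have Q: "Q \<in> forms" "discr Q > 0" "\<nexists>k. discr Q = k\<^sup>2" "coeff_xx Q \<noteq> 0"
    using assms coeff_xx_nonzero by (auto simp: F_plus_iff)
  interpret G: comm_group "stab_group Q"
    using comm_group_stab_group[OF Q(1)] .
  let ?\<psi> = "stab_unit Q"
  let ?h = "- mat 1 :: real^2^2"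
  note mem = mat1_in_stab[OF Q(1)]
  obtain t u where tu: "t\<^sup>2 - discr Q * u\<^sup>2 \<in> {4, -4}" "(of_int t + of_int u * sqrt (discr Q)) / 2 > 1"
    and least: "\<And>t' u'. t'\<^sup>2 - discr Q * u'\<^sup>2 \<in> {4, -4} \<Longrightarrow> (of_int t' + of_int u' * sqrt (discr Q)) / 2 > 1 \<Longrightarrow>
        (of_int t + of_int u * sqrt (discr Q)) / 2 \<le> (of_int t' + of_int u' * sqrt (discr Q)) / 2"
    by (rule fundamental_unit_exists[OF Q(2,3)]) blast
  define E where "E = stab_elt Q t u"
  define \<epsilon> where "\<epsilon> = ?\<psi> E"
  have E: "E \<in> stab Q"
    using tu(1) by (simp only: E_def stab_elt_in_stab_iff[OF Q(1)])
  have "\<epsilon> > 1"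
    using tu(2) by (simp add: \<epsilon>_def E_def stab_unit_stab_elt[OF Q(4)])
  have min: "\<epsilon> \<le> ?\<psi> M" if M: "M \<in> stab Q" "?\<psi> M > 1" for M
    proof -
    obtain t' u' where tu': "M = stab_elt Q t' u'" "t'\<^sup>2 - discr Q * u'\<^sup>2 \<in> {4, -4}"
      using stabE[OF Q(1) M(1)] .
    show ?thesis
      using M(2) least[OF tu'(2)] by (simp add: tu'(1) \<epsilon>_def E_def stab_unit_stab_elt[OF Q(4)])
  qed
  have \<psi>h: "?\<psi> ?h = -1"
    using stab_unit_stab_elt[OF Q(4), of "-2" 0] by (simp add: minus_mat1_eq_stab_elt[of Q])
  have \<psi>1: "?\<psi> (mat 1) = 1"
    using stab_unit_eq_1_iff[OF assms mem(1)] by simp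
  note mult = stab_unit_mult[OF assms]
  have pow: "?\<psi> (M [^]\<^bsub>stab_group Q\<^esub> n) = ?\<psi> M powi n" if "M \<in> stab Q" for M and n :: int
    using that by (intro G.power_int_of_mult_hom) (simp_all add: mult \<psi>1)
  have closed: "M [^]\<^bsub>stab_group Q\<^esub> n \<in> stab Q" if "M \<in> stab Q" for M and n :: int
    using that G.int_pow_closed[of M n] by simp
  have pos: "\<exists>n::int. M = E [^]\<^bsub>stab_group Q\<^esub> n" if M: "M \<in> stab Q" "?\<psi> M > 0" for M
  proof -
    obtain n :: int where n: "\<epsilon> powi n \<le> ?\<psi> M" "?\<psi> M < \<epsilon> powi n * \<epsilon>"
      using power_int_bounds[OF \<open>\<epsilon> > 1\<close> M(2)] .
    \<comment> \<open>Dividing by the largest power of \<epsilon> not exceeding the value of M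
      leaves a value in [1, \<epsilon>). Minimality of \<epsilon> makes that value 1.\<close>
    define N where "N = M ** (E [^]\<^bsub>stab_group Q\<^esub> (- n))"
    have N: "N \<in> stab Q"
      unfolding N_def using stab_mult_closed[OF Q(1) M(1)] closed[OF E] by blast
    have "?\<psi> N = ?\<psi> M / \<epsilon> powi n"
      unfolding N_def mult[OF M(1) closed[OF E]] pow[OF E] \<epsilon>_def[symmetric]
      by (simp add: power_int_minus field_simps)
    moreover have "\<epsilon> powi n > 0"
      using \<open>\<epsilon> > 1\<close> by simp
    ultimately have "1 \<le> ?\<psi> N" "?\<psi> N < \<epsilon>"
      using n by (simp_all add: field_simps)
    with min[OF N] have "?\<psi> N = 1"
      by linarith
    then have "N = mat 1"
      using stab_unit_eq_1_iff[OF assms N] by simp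
    then have "M \<otimes>\<^bsub>stab_group Q\<^esub> inv\<^bsub>stab_group Q\<^esub> (E [^]\<^bsub>stab_group Q\<^esub> n) = \<one>\<^bsub>stab_group Q\<^esub>"
      using E by (simp add: N_def G.int_pow_neg)
    then have "M = E [^]\<^bsub>stab_group Q\<^esub> n"
      using M(1) E by (metis G.int_pow_closed G.inv_closed G.inv_inv G.inv_unique' G.l_one G.m_comm stab_group_simps(1))
    then show ?thesis ..
  qed
  have "stab_group Q \<cong> integer_mod_group 2 \<times>\<times> integer_mod_group 0"
  proof (rule conjunct2[OF stab_two_generators[OF Q(1) E]])
    show "E [^]\<^bsub>stab_group Q\<^esub> (0::nat) = mat 1"
      by simp
  next
    fix M assume M: "M \<in> stab Q"
    show "\<exists>j::int. M = E [^]\<^bsub>stab_group Q\<^esub> j \<or> M = ?h ** E [^]\<^bsub>stab_group Q\<^esub> j"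
    proof (cases "?\<psi> M > 0")
      case True
      then show ?thesis
        using pos M by blast
    next
      case False
      have "?\<psi> M \<noteq> 0"
        using mult[OF M, of "inv\<^bsub>stab_group Q\<^esub> M"] G.r_inv[of M] G.inv_closed[of M] M \<psi>1 by auto
      with False have "?\<psi> (?h ** M) > 0"
        using mult[OF mem(2) M] \<psi>h by simp
      then obtain j :: int where "?h ** M = E [^]\<^bsub>stab_group Q\<^esub> j"
        using pos stab_mult_closed[OF Q(1) mem(2) M] by blast
      moreover have "M = ?h ** (?h ** M)"
        by (simp add: matrix_mul_assoc minus_mat1_square)
      ultimately show ?thesis
        by metis
    qed
  next
    fix j :: int
    \<comment> \<open>Powers of E have positive value and -I has value -1, so -I is not a power of
      E.\<close>
    have "\<epsilon> powi j > 0"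
      using \<open>\<epsilon> > 1\<close> by simp
    then have "?\<psi> (?h ** E [^]\<^bsub>stab_group Q\<^esub> j) < 0"
      by (simp add: mult[OF mem(2) closed[OF E]] pow[OF E] \<psi>h flip: \<epsilon>_def)
    then show "?h ** E [^]\<^bsub>stab_group Q\<^esub> j \<noteq> mat 1"
      using \<psi>1 by auto
    assume "E [^]\<^bsub>stab_group Q\<^esub> j = mat 1"
    then have "\<epsilon> powi j = 1"
      using pow[OF E, of j] \<psi>1 by (simp add: \<epsilon>_def)
    then show "j = 0"
      using \<open>\<epsilon> > 1\<close> power_int_strict_increasing[of j 0 \<epsilon>] power_int_strict_increasing[of 0 j \<epsilon>]
      by (cases j "0::int" rule: linorder_cases) auto
  qed
  then show ?thesis
    by (simp add: integer_mod_group_def)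
qed

section \<open>Solving t^2 - \<Delta>u^2 = \<plusminus>4 for the remaining discriminants\<close>

lemma abs_le_of_square_le:
  fixes t n :: int
  assumes "t\<^sup>2 \<le> n\<^sup>2" "n \<ge> 0"
  shows "\<bar>t\<bar> \<le> n"
  using assms abs_le_square_iff[of t n] by simp

text \<open>The generator corresponds to \<surd>(-4)/2, a primitive fourth root of unity. Its powers
  exhaust the four solutions of t^2 + 4u^2 = 4.\<close>

lemma stab_cyclic_neg4:
  assumes Q: "Q \<in> forms" and d: "discr Q = -4"
  shows "stab Q = generate GL2Z {stab_elt Q 0 1} \<and> stab_group Q \<cong> integer_mod_group 4"
proof -
  interpret G: comm_group "stab_group Q"
    using comm_group_stab_group[OF Q] .
  let ?x = "stab_elt Q 0 1"
  have x: "?x \<in> stab Q"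
    by (simp add: stab_elt_in_stab_iff[OF Q] d)
  \<comment> \<open>Multiplication by the generator sends (t, u) to (-2u, t/2).\<close>
  have mul: "stab_elt Q t u ** ?x = stab_elt Q (-2 * u) t'" if "t = 2 * t'" for t u t'
    using that by (intro stab_elt_mult) (simp_all add: d)
  have p2: "?x [^]\<^bsub>stab_group Q\<^esub> (2::nat) = stab_elt Q (-2) 0"
    and p3: "?x [^]\<^bsub>stab_group Q\<^esub> (3::nat) = stab_elt Q 0 (-1)"
    and p4: "?x [^]\<^bsub>stab_group Q\<^esub> (4::nat) = stab_elt Q 2 0"
    using x by (simp_all add: numeral_eq_Suc mul[of 0 0] mul[of "-2" "-1"])
  have pow: "?x [^]\<^bsub>stab_group Q\<^esub> (0::int) = stab_elt Q 2 0"
    "?x [^]\<^bsub>stab_group Q\<^esub> (1::int) = stab_elt Q 0 1"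
    "?x [^]\<^bsub>stab_group Q\<^esub> (2::int) = stab_elt Q (-2) 0"
    "?x [^]\<^bsub>stab_group Q\<^esub> (3::int) = stab_elt Q 0 (-1)"
    using x p2 p3 by (simp_all add: int_pow_def2 flip: mat1_eq_stab_elt)
  show ?thesis
  proof (rule stab_cyclic[OF Q x])
    show "?x [^]\<^bsub>stab_group Q\<^esub> (4::nat) = mat 1"
      unfolding mat1_eq_stab_elt[of Q] by (rule p4)
  next
    show "stab Q \<subseteq> range (\<lambda>i::int. ?x [^]\<^bsub>stab_group Q\<^esub> i)"
    proof
      fix M assume "M \<in> stab Q"
      then obtain t u where M: "M = stab_elt Q t u" and tu: "t\<^sup>2 - discr Q * u\<^sup>2 \<in> {4, -4}"
        using stabE[OF Q] by blast
      have sol: "t\<^sup>2 + 4 * u\<^sup>2 = 4"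
        using tu d zero_le_power2[of t] zero_le_power2[of u] by auto
      then have "t\<^sup>2 \<le> 4" "u\<^sup>2 \<le> 1"
        using zero_le_power2[of t] zero_le_power2[of u] by linarith+
      then have "\<bar>t\<bar> \<le> 2" "\<bar>u\<bar> \<le> 1"
        using abs_le_of_square_le[of t 2] abs_le_of_square_le[of u 1] by simp_all
      then have "t = -2 \<or> t = -1 \<or> t = 0 \<or> t = 1 \<or> t = 2" "u = -1 \<or> u = 0 \<or> u = 1"
        by arith+
      with sol have "t = 2 \<and> u = 0 \<or> t = -2 \<and> u = 0 \<or> t = 0 \<and> u = 1 \<or> t = 0 \<and> u = -1"
        by auto
      then show "M \<in> range (\<lambda>i::int. ?x [^]\<^bsub>stab_group Q\<^esub> i)"
        unfolding M using pow by (metis rangeI)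
    qed
  next
    fix i assume "i \<in> carrier (integer_mod_group 4)" and 1: "?x [^]\<^bsub>stab_group Q\<^esub> i = mat 1"
    then have "i = 0 \<or> i = 1 \<or> i = 2 \<or> i = 3"
      by (auto simp: carrier_integer_mod_group)
    moreover have "?x [^]\<^bsub>stab_group Q\<^esub> (1::int) \<noteq> mat 1" "?x [^]\<^bsub>stab_group Q\<^esub> (2::int) \<noteq> mat 1"
      "?x [^]\<^bsub>stab_group Q\<^esub> (3::int) \<noteq> mat 1"
      unfolding pow mat1_eq_stab_elt[of Q] stab_elt_eq_iff[OF Q] by simp_all
    ultimately show "i = 0"
      using 1 by metis
  qed
qed

text \<open>The generator corresponds to (1 + \<surd>(-3))/2, a primitive sixth root of unity. Its
  powers exhaust the six solutions of t^2 + 3u^2 = 4.\<close>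

lemma stab_cyclic_neg3:
  assumes Q: "Q \<in> forms" and d: "discr Q = -3"
  shows "stab Q = generate GL2Z {stab_elt Q 1 1} \<and> stab_group Q \<cong> integer_mod_group 6"
proof -
  interpret G: comm_group "stab_group Q"
    using comm_group_stab_group[OF Q] .
  let ?x = "stab_elt Q 1 1"
  have x: "?x \<in> stab Q"
    by (simp add: stab_elt_in_stab_iff[OF Q] d)
  have mul: "stab_elt Q t u ** ?x = stab_elt Q t' u'" if "2 * t' = t - 3 * u" "2 * u' = t + u" for t u t' u'
    using that by (intro stab_elt_mult) (simp_all add: d)
  have p2: "?x [^]\<^bsub>stab_group Q\<^esub> (2::nat) = stab_elt Q (-1) 1"
    and p3: "?x [^]\<^bsub>stab_group Q\<^esub> (3::nat) = stab_elt Q (-2) 0"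
    and p4: "?x [^]\<^bsub>stab_group Q\<^esub> (4::nat) = stab_elt Q (-1) (-1)"
    and p5: "?x [^]\<^bsub>stab_group Q\<^esub> (5::nat) = stab_elt Q 1 (-1)"
    and p6: "?x [^]\<^bsub>stab_group Q\<^esub> (6::nat) = stab_elt Q 2 0"
    using x by (simp_all add: numeral_eq_Suc mul[of "-1" 1 1] mul[of "-2" "-1" 1] mul[of "-1" "-2" 0]
        mul[of 1 "-1" "-1"] mul[of 2 1 "-1"])
  have pow: "?x [^]\<^bsub>stab_group Q\<^esub> (0::int) = stab_elt Q 2 0"
    "?x [^]\<^bsub>stab_group Q\<^esub> (1::int) = stab_elt Q 1 1"
    "?x [^]\<^bsub>stab_group Q\<^esub> (2::int) = stab_elt Q (-1) 1"
    "?x [^]\<^bsub>stab_group Q\<^esub> (3::int) = stab_elt Q (-2) 0"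
    "?x [^]\<^bsub>stab_group Q\<^esub> (4::int) = stab_elt Q (-1) (-1)"
    "?x [^]\<^bsub>stab_group Q\<^esub> (5::int) = stab_elt Q 1 (-1)"
    using x p2 p3 p4 p5 by (simp_all add: int_pow_def2 flip: mat1_eq_stab_elt)
  show ?thesis
  proof (rule stab_cyclic[OF Q x])
    show "?x [^]\<^bsub>stab_group Q\<^esub> (6::nat) = mat 1"
      unfolding mat1_eq_stab_elt[of Q] by (rule p6)
  next
    show "stab Q \<subseteq> range (\<lambda>i::int. ?x [^]\<^bsub>stab_group Q\<^esub> i)"
    proof
      fix M assume "M \<in> stab Q"
      then obtain t u where M: "M = stab_elt Q t u" and tu: "t\<^sup>2 - discr Q * u\<^sup>2 \<in> {4, -4}"
        using stabE[OF Q] by blast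
      have sol: "t\<^sup>2 + 3 * u\<^sup>2 = 4"
        using tu d zero_le_power2[of t] zero_le_power2[of u] by auto
      then have "t\<^sup>2 \<le> 4" "u\<^sup>2 \<le> 1"
        using zero_le_power2[of t] zero_le_power2[of u] by linarith+
      then have "\<bar>t\<bar> \<le> 2" "\<bar>u\<bar> \<le> 1"
        using abs_le_of_square_le[of t 2] abs_le_of_square_le[of u 1] by simp_all
      then have "t = -2 \<or> t = -1 \<or> t = 0 \<or> t = 1 \<or> t = 2" "u = -1 \<or> u = 0 \<or> u = 1"
        by arith+
      with sol have "t = 2 \<and> u = 0 \<or> t = 1 \<and> u = 1 \<or> t = -1 \<and> u = 1 \<or>
          t = -2 \<and> u = 0 \<or> t = -1 \<and> u = -1 \<or> t = 1 \<and> u = -1"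
        by auto
      then show "M \<in> range (\<lambda>i::int. ?x [^]\<^bsub>stab_group Q\<^esub> i)"
        unfolding M using pow by (metis rangeI)
    qed
  next
    fix i assume "i \<in> carrier (integer_mod_group 6)" and 1: "?x [^]\<^bsub>stab_group Q\<^esub> i = mat 1"
    then have "i = 0 \<or> i = 1 \<or> i = 2 \<or> i = 3 \<or> i = 4 \<or> i = 5"
      by (auto simp: carrier_integer_mod_group)
    moreover have "?x [^]\<^bsub>stab_group Q\<^esub> (1::int) \<noteq> mat 1" "?x [^]\<^bsub>stab_group Q\<^esub> (2::int) \<noteq> mat 1"
      "?x [^]\<^bsub>stab_group Q\<^esub> (3::int) \<noteq> mat 1" "?x [^]\<^bsub>stab_group Q\<^esub> (4::int) \<noteq> mat 1"
      "?x [^]\<^bsub>stab_group Q\<^esub> (5::int) \<noteq> mat 1"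
      unfolding pow mat1_eq_stab_elt[of Q] stab_elt_eq_iff[OF Q] by simp_all
    ultimately show "i = 0"
      using 1 by metis
  qed
qed

text \<open>Common form of discriminants 1 (v = 2) and 4 (v = 1): the second generator vSQ is an
  involution, since its square is (\<Delta>v^2/4) I = I.\<close>

lemma stab_klein:
  assumes Q: "Q \<in> forms" and d: "discr Q * v\<^sup>2 = 4"
    and sol: "\<And>t u. t\<^sup>2 - discr Q * u\<^sup>2 \<in> {4, -4} \<Longrightarrow> u = 0 \<and> (t = 2 \<or> t = -2) \<or> t = 0 \<and> (u = v \<or> u = -v)"
  shows "stab Q = generate GL2Z {- mat 1, stab_elt Q 0 v} \<and>
    stab_group Q \<cong> integer_mod_group 2 \<times>\<times> integer_mod_group 2"
proof -
  interpret G: comm_group "stab_group Q"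
    using comm_group_stab_group[OF Q] .
  let ?y = "stab_elt Q 0 v"
  have y: "?y \<in> stab Q"
    by (simp add: stab_elt_in_stab_iff[OF Q] d)
  have "?y ** ?y = stab_elt Q 2 0"
    using d by (intro stab_elt_mult) (simp_all add: power2_eq_square)
  then have p2: "?y [^]\<^bsub>stab_group Q\<^esub> (2::nat) = mat 1"
    using y by (simp add: numeral_2_eq_2 flip: mat1_eq_stab_elt)
  have pow: "?y [^]\<^bsub>stab_group Q\<^esub> (0::int) = stab_elt Q 2 0"
    "?y [^]\<^bsub>stab_group Q\<^esub> (1::int) = stab_elt Q 0 v"
    using y by (simp_all flip: mat1_eq_stab_elt)
  show ?thesis
  proof (rule stab_two_generators[OF Q y p2])
    fix M assume "M \<in> stab Q"
    then obtain t u where M: "M = stab_elt Q t u" and "t\<^sup>2 - discr Q * u\<^sup>2 \<in> {4, -4}"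
      using stabE[OF Q] by blast
    from sol[OF this(2)]
    show "\<exists>j::int. M = ?y [^]\<^bsub>stab_group Q\<^esub> j \<or> M = - mat 1 ** ?y [^]\<^bsub>stab_group Q\<^esub> j"
      unfolding M using pow minus_mat1_mult_stab_elt[of Q]
      by (metis minus_zero)
  next
    fix j assume "j \<in> carrier (integer_mod_group 2)"
    then have "j = 0 \<or> j = 1"
      by (auto simp: carrier_integer_mod_group)
    moreover have "?y [^]\<^bsub>stab_group Q\<^esub> (1::int) \<noteq> mat 1" "- mat 1 ** ?y [^]\<^bsub>stab_group Q\<^esub> (0::int) \<noteq> mat 1"
      "- mat 1 ** ?y [^]\<^bsub>stab_group Q\<^esub> (1::int) \<noteq> mat 1"
      unfolding pow minus_mat1_mult_stab_elt unfolding mat1_eq_stab_elt[of Q] stab_elt_eq_iff[OF Q]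
      by simp_all
    ultimately show "?y [^]\<^bsub>stab_group Q\<^esub> j = mat 1 \<Longrightarrow> j = 0"
      and "- mat 1 ** ?y [^]\<^bsub>stab_group Q\<^esub> j \<noteq> mat 1"
      by metis+
  qed
qed

text \<open>Here (SQ)^2 = 0, so I + SQ is unipotent with n-th power I + nSQ. The equation reduces to
  t = \<plusminus>2 with u arbitrary.\<close>

lemma stab_discr_0:
  assumes Q: "Q \<in> forms" and d: "discr Q = 0"
  shows "stab Q = generate GL2Z {- mat 1, stab_elt Q 2 1} \<and>
    stab_group Q \<cong> integer_mod_group 2 \<times>\<times> integer_mod_group 0"
proof -
  interpret G: comm_group "stab_group Q"
    using comm_group_stab_group[OF Q] .
  let ?y = "stab_elt Q 2 1"
  have mem: "stab_elt Q 2 n \<in> stab Q" for n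
    by (simp add: stab_elt_in_stab_iff[OF Q] d)
  have mul: "stab_elt Q 2 m ** stab_elt Q 2 n = stab_elt Q 2 (m + n)" for m n
    by (rule stab_elt_mult) (simp_all add: d)
  have nat: "?y [^]\<^bsub>stab_group Q\<^esub> n = stab_elt Q 2 (int n)" for n :: nat
    by (induction n) (simp_all add: mul mat1_eq_stab_elt[of Q] add.commute)
  have inv: "inv\<^bsub>stab_group Q\<^esub> (stab_elt Q 2 n) = stab_elt Q 2 (- n)" for n
    using mem by (intro G.inv_equality) (simp_all add: mul flip: mat1_eq_stab_elt)
  have pow: "?y [^]\<^bsub>stab_group Q\<^esub> n = stab_elt Q 2 n" for n :: int
    unfolding int_pow_def2 by (simp add: nat inv del: pow_nat)
  show ?thesis
  proof (rule stab_two_generators[OF Q mem])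
    show "?y [^]\<^bsub>stab_group Q\<^esub> (0::nat) = mat 1"
      by simp
  next
    fix M assume "M \<in> stab Q"
    then obtain t u where M: "M = stab_elt Q t u" and "t\<^sup>2 - discr Q * u\<^sup>2 \<in> {4, -4}"
      using stabE[OF Q] by blast
    then have "t\<^sup>2 = 4 \<or> t\<^sup>2 = -4"
      by (simp add: d)
    moreover have "t\<^sup>2 \<ge> 0"
      by simp
    ultimately have "t\<^sup>2 = 2\<^sup>2"
      by auto
    then have "t = 2 \<or> t = -2"
      by (simp only: power2_eq_iff)
    then show "\<exists>j::int. M = ?y [^]\<^bsub>stab_group Q\<^esub> j \<or> M = - mat 1 ** ?y [^]\<^bsub>stab_group Q\<^esub> j"
      unfolding M pow minus_mat1_mult_stab_elt by (metis minus_minus)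
  next
    fix j :: int
    show "j = 0" if "?y [^]\<^bsub>stab_group Q\<^esub> j = mat 1"
      using that unfolding pow mat1_eq_stab_elt[of Q] stab_elt_eq_iff[OF Q] by simp
    show "- mat 1 ** ?y [^]\<^bsub>stab_group Q\<^esub> j \<noteq> mat 1"
      unfolding pow minus_mat1_mult_stab_elt unfolding mat1_eq_stab_elt[of Q] stab_elt_eq_iff[OF Q]
      by simp
  qed
qed

text \<open>For square \<Delta> = k^2 the left side factors as (|t| - k|u|)(|t| + k|u|), so |t| +
  k|u| divides 4.\<close>

lemma square_discr_solution_bound:
  fixes t u k :: int
  assumes "t\<^sup>2 - k\<^sup>2 * u\<^sup>2 \<in> {4, -4}" "k \<ge> 0"
  shows "\<bar>t\<bar> + k * \<bar>u\<bar> \<le> 4"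
proof -
  have "(\<bar>t\<bar> - k * \<bar>u\<bar>) * (\<bar>t\<bar> + k * \<bar>u\<bar>) = \<bar>t\<bar>\<^sup>2 - k\<^sup>2 * \<bar>u\<bar>\<^sup>2"
    by algebra
  also have "\<dots> = t\<^sup>2 - k\<^sup>2 * u\<^sup>2"
    by simp
  finally have "(\<bar>t\<bar> + k * \<bar>u\<bar>) dvd t\<^sup>2 - k\<^sup>2 * u\<^sup>2"
    by (metis dvd_triv_right)
  then have "(\<bar>t\<bar> + k * \<bar>u\<bar>) dvd 4"
    using assms(1) by auto
  then show ?thesis
    by (rule zdvd_imp_le) simp
qed

text \<open>In each case u = 0. A negative discriminant other than -3 and -4 is at most -5, and u
  \<noteq> 0 would make t^2 - \<Delta>u^2 at least 5. A positive one is a square k^2 with k \<ge> 3;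
  then |t| + k|u| \<le> 4 leaves for u \<noteq> 0 only |u| = 1, k = 3 or 4 and |t| \<le> 1, none of
  which gives \<plusminus>4.\<close>

lemma stab_trivial:
  assumes "Q \<in> forms" "Q \<notin> F_plus \<union> F_minus"
  shows "stab Q = {mat 1, - mat 1}"
proof -
  define d where "d = discr Q"
  have d: "d \<noteq> -4" "d \<noteq> -3" "d \<noteq> 0" "d \<noteq> 1" "d \<noteq> 4" and sq: "d > 0 \<Longrightarrow> \<exists>k. d = k\<^sup>2"
    using assms by (auto simp: d_def F_plus_iff F_minus_def)
  have sol: "u = 0 \<and> (t = 2 \<or> t = -2)" if tu: "t\<^sup>2 - d * u\<^sup>2 \<in> {4, -4}" for t u
  proof -
    have "u = 0"
    proof (cases "d > 0")
      case True
      then obtain k' where "d = k'\<^sup>2"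
        using sq by blast
      then obtain k where k: "d = k\<^sup>2" "k \<ge> 0"
        by (metis abs_ge_zero power2_abs)
      have "k \<noteq> 0" "k \<noteq> 1" "k \<noteq> 2"
        using d k by auto
      with k(2) have "k \<ge> 3"
        by linarith
      have bound: "\<bar>t\<bar> + k * \<bar>u\<bar> \<le> 4"
        using square_discr_solution_bound[of t k u] tu k by simp
      show "u = 0"
      proof (rule ccontr)
        assume "u \<noteq> 0"
        have "\<bar>u\<bar> < 2"
        proof (rule ccontr)
          assume "\<not> \<bar>u\<bar> < 2"
          then have "3 * 2 \<le> k * \<bar>u\<bar>"
            using \<open>k \<ge> 3\<close> by (intro mult_mono) auto
          with bound show False by linarith
        qed
        with \<open>u \<noteq> 0\<close> have u: "\<bar>u\<bar> = 1"
          by linarith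
        then have "u\<^sup>2 = 1"
          by (metis power2_abs one_power2)
        moreover have "k = 3 \<or> k = 4" "\<bar>t\<bar> \<le> 1"
          using bound \<open>k \<ge> 3\<close> u by auto
        moreover have "t = -1 \<or> t = 0 \<or> t = 1"
          using \<open>\<bar>t\<bar> \<le> 1\<close> by arith
        ultimately show False
          using tu k(1) by auto
      qed
    next
      case False
      have "d mod 4 = 0 \<or> d mod 4 = 1"
        unfolding d_def by (rule discr_mod_4)
      with False d have "d \<le> -5"
        by presburger
      show "u = 0"
      proof (rule ccontr)
        assume "u \<noteq> 0"
        then have "u\<^sup>2 \<ge> 1"
          by (metis int_one_le_iff_zero_less zero_less_power2)
        then have "5 * 1 \<le> (- d) * u\<^sup>2"
          using \<open>d \<le> -5\<close> by (intro mult_mono) auto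
        moreover have "t\<^sup>2 - d * u\<^sup>2 \<le> 4"
          using tu by auto
        ultimately show False
          using zero_le_power2[of t] by simp
      qed
    qed
    moreover have "t\<^sup>2 = 2\<^sup>2"
      using tu \<open>u = 0\<close> zero_le_power2[of t] by auto
    then have "t = 2 \<or> t = -2"
      by (simp only: power2_eq_iff)
    ultimately show ?thesis ..
  qed
  show ?thesis
  proof (intro equalityI subsetI)
    fix M assume "M \<in> stab Q"
    then obtain t u where "M = stab_elt Q t u" "t\<^sup>2 - discr Q * u\<^sup>2 \<in> {4, -4}"
      using stabE[OF assms(1)] by blast
    then show "M \<in> {mat 1, - mat 1}"
      using sol[of t u] by (auto simp: d_def simp flip: mat1_eq_stab_elt minus_mat1_eq_stab_elt)
  qed (use mat1_in_stab[OF assms(1)] in auto)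
qed

lemma stab_discr_1:
  assumes "Q \<in> forms" "discr Q = 1"
  shows "stab Q = generate GL2Z {- mat 1, stab_elt Q 0 2} \<and>
    stab_group Q \<cong> integer_mod_group 2 \<times>\<times> integer_mod_group 2"
proof (rule stab_klein)
  fix t u assume tu: "t\<^sup>2 - discr Q * u\<^sup>2 \<in> {4, -4}"
  then have "\<bar>t\<bar> + \<bar>u\<bar> \<le> 4"
    using square_discr_solution_bound[of t 1 u] assms by simp
  then have "t = -4 \<or> t = -3 \<or> t = -2 \<or> t = -1 \<or> t = 0 \<or> t = 1 \<or> t = 2 \<or> t = 3 \<or> t = 4"
    "u = -4 \<or> u = -3 \<or> u = -2 \<or> u = -1 \<or> u = 0 \<or> u = 1 \<or> u = 2 \<or> u = 3 \<or> u = 4"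
    by arith+
  with tu show "u = 0 \<and> (t = 2 \<or> t = -2) \<or> t = 0 \<and> (u = 2 \<or> u = -2)"
    unfolding assms(2) by (elim disjE) simp_all
qed (use assms in simp_all)

lemma stab_discr_4:
  assumes "Q \<in> forms" "discr Q = 4"
  shows "stab Q = generate GL2Z {- mat 1, stab_elt Q 0 1} \<and>
    stab_group Q \<cong> integer_mod_group 2 \<times>\<times> integer_mod_group 2"
proof (rule stab_klein)
  fix t u assume tu: "t\<^sup>2 - discr Q * u\<^sup>2 \<in> {4, -4}"
  then have "\<bar>t\<bar> + 2 * \<bar>u\<bar> \<le> 4"
    using square_discr_solution_bound[of t 2 u] assms by simp
  then have "t = -4 \<or> t = -3 \<or> t = -2 \<or> t = -1 \<or> t = 0 \<or> t = 1 \<or> t = 2 \<or> t = 3 \<or> t = 4"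
    "u = -2 \<or> u = -1 \<or> u = 0 \<or> u = 1 \<or> u = 2"
    by arith+
  with tu show "u = 0 \<and> (t = 2 \<or> t = -2) \<or> t = 0 \<and> (u = 1 \<or> u = -1)"
    unfolding assms(2) by (elim disjE) simp_all
qed (use assms in simp_all)

theorem theorem4p43:
  fixes Q :: bqf
  assumes "Q \<in> forms"
  shows "(Q \<notin> F_plus \<union> F_minus \<longrightarrow> stab Q = {mat 1, - mat 1}) \<and>
    (Q \<in> F_plus \<longrightarrow>
      stab Q = chi Q ` order_units Q \<and>
      stab_group Q \<cong> integer_mod_group 2 \<times>\<times> integer_group) \<and>
    (Q \<in> F_minus \<longrightarrow>
      (discr Q = -4 \<longrightarrow>
        stab Q = generate GL2Z {S_mat ** form_mat Q} \<and>
        stab_group Q \<cong> integer_mod_group 4) \<and>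
      (discr Q = -3 \<longrightarrow>
        stab Q = generate GL2Z {(1/2) *\<^sub>R mat 1 + S_mat ** form_mat Q} \<and>
        stab_group Q \<cong> integer_mod_group 6) \<and>
      (discr Q = 0 \<longrightarrow>
        stab Q = generate GL2Z {- mat 1, mat 1 + S_mat ** form_mat Q} \<and>
        stab_group Q \<cong> integer_mod_group 2 \<times>\<times> integer_group) \<and>
      (discr Q = 1 \<longrightarrow>
        stab Q = generate GL2Z {- mat 1, 2 *\<^sub>R (S_mat ** form_mat Q)} \<and>
        stab_group Q \<cong> integer_mod_group 2 \<times>\<times> integer_mod_group 2) \<and>
      (discr Q = 4 \<longrightarrow>
        stab Q = generate GL2Z {- mat 1, S_mat ** form_mat Q} \<and>
        stab_group Q \<cong> integer_mod_group 2 \<times>\<times> integer_mod_group 2))"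
proof -
  have Z: "integer_mod_group 0 = integer_group"
    by (simp add: integer_mod_group_def)
  show ?thesis
    \<comment> \<open>The equation for SQ alone comes last, because its left side is a subterm of
      the other three.\<close>
    unfolding S_form_eq_stab_elt(1-3) unfolding S_form_eq_stab_elt(4)
    using stab_trivial[OF assms] stab_eq_chi_order_units[of Q] stab_group_iso_F_plus[of Q]
      stab_cyclic_neg4[OF assms] stab_cyclic_neg3[OF assms] stab_discr_0[OF assms, unfolded Z]
      stab_discr_1[OF assms] stab_discr_4[OF assms]
    by argo
qed

end
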